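(* Fix an integer $\ell\ge 3$. There exists $C>0$ such that for every $1\le m\le \frac{n}{64\ell^2}$ and every $n$-vertex graph $G$ with minimum degree $\delta(G)\ge m$, if $p\ge C\log n/n$ then asymptotically almost surely $G\cup G(n,p)$ contains $m$ pairwise vertex-disjoint copies of $C_\ell$.
   Context: $C_\ell$ is the cycle on $\ell$ vertices. $G(n,p)$ is the binomial random graph on $V(G)$ (each pair an edge independently with probability $p$), and $G\cup G(n,p)$ has as edge set the union of both edge sets. "Asymptotically almost surely" means with probability tending to $1$ as $n\to\infty$, for any sequences $m=m_n$, $G=G_n$ satisfying the hypotheses. *)

theory Defs
  imports "HOL-Probability.Probability"
begin

definition all_pairs :: "nat \<Rightarrow> nat set set" where
  "all_pairs n = {e. \<exists>i j. i < j \<and> j < n \<and> e = {i, j}}"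

definition is_graph :: "nat \<Rightarrow> nat set set \<Rightarrow> bool" where
  "is_graph n E \<longleftrightarrow> E \<subseteq> all_pairs n"

definition degree :: "nat set set \<Rightarrow> nat \<Rightarrow> nat" where
  "degree E v = card {u. {u, v} \<in> E}"

definition min_degree_ge :: "nat \<Rightarrow> nat set set \<Rightarrow> nat \<Rightarrow> bool" where
  "min_degree_ge n E d \<longleftrightarrow> (\<forall>v<n. d \<le> degree E v)"

definition gnp :: "nat \<Rightarrow> real \<Rightarrow> nat set set pmf" where
  "gnp n p = map_pmf (\<lambda>f. {e \<in> all_pairs n. f e})
       (Pi_pmf (all_pairs n) False (\<lambda>_. bernoulli_pmf p))"

definition cycle_copy :: "nat \<Rightarrow> nat set set \<Rightarrow> nat \<Rightarrow> (nat \<Rightarrow> nat) \<Rightarrow> bool" where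
  "cycle_copy n E l f \<longleftrightarrow> inj_on f {..<l} \<and> f ` {..<l} \<subseteq> {..<n} \<and>
     (\<forall>i<l. {f i, f (Suc i mod l)} \<in> E)"

definition has_disjoint_cycles :: "nat \<Rightarrow> nat set set \<Rightarrow> nat \<Rightarrow> nat \<Rightarrow> bool" where
  "has_disjoint_cycles n E l m \<longleftrightarrow> (\<exists>F :: nat \<Rightarrow> nat \<Rightarrow> nat.
     (\<forall>k<m. cycle_copy n E l (F k)) \<and>
     (\<forall>k<m. \<forall>k'<m. k \<noteq> k' \<longrightarrow> F k ` {..<l} \<inter> F k' ` {..<l} = {}))"

end

theory Submission
  imports Defs
begin

text \<open>
  With high probability any two disjoint vertex sets of size \<open>s\<close>, a small fraction of \<open>n\<close>, are
  joined by a random edge; then every set of size \<open>2 * s * t\<close> contains a random path on \<open>t\<close>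
  vertices. Hence a hub, a vertex with at least \<open>n / (32 * l)\<close> neighbours in \<open>G\<close>, lies on a cycle
  whose other \<open>l - 1\<close> vertices form a random path among its unused neighbours.

  It remains to find \<open>b = m - h\<close> cycles off \<open>h < m\<close> hubs. There \<open>G\<close> has minimum degree at least \<open>b\<close>
  and maximum degree below \<open>n / (32 * l)\<close>, so after the removal of any \<open>l * b\<close> vertices \<open>U\<close> it still
  has a bipartite subgraph \<open>(X, Y)\<close> with at least \<open>n * b / 16\<close> edges outside a reserve \<open>W\<close> of linear
  size. In \<open>W\<close> there are linearly many disjoint random paths on \<open>l - 2\<close> vertices. Independently
  for each path, some edge of \<open>(X, Y)\<close> closes it to a cycle, with failure probability at most
  \<open>exp (- (p * b / 256))\<close>. Altogether this fails with probability at most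
  \<open>exp (- (2 * l * b * ln n))\<close>, which beats the \<open>n ^ (l * b)\<close> choices of \<open>U\<close>, so a greedy choice of
  the cycles succeeds.
\<close>

section \<open>Random subsets\<close>

text \<open>The ground set is arbitrary so that the pairs of vertices can be split and exposed in
  stages.\<close>

definition random_subset :: "real \<Rightarrow> 'a set \<Rightarrow> 'a set pmf" where
  "random_subset p A = map_pmf (\<lambda>f. {e \<in> A. f e}) (Pi_pmf A False (\<lambda>_. bernoulli_pmf p))"

lemma gnp_eq_random_subset: "gnp n p = random_subset p (all_pairs n)"
  by (simp add: gnp_def random_subset_def)

lemma set_pmf_random_subset: "finite A \<Longrightarrow> R \<in> set_pmf (random_subset p A) \<Longrightarrow> R \<subseteq> A"
  by (auto simp: random_subset_def)

lemma random_subset_union: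
  assumes "finite A" "finite B" "A \<inter> B = {}"
  shows "random_subset p (A \<union> B) =
    bind_pmf (random_subset p A) (\<lambda>S. map_pmf (\<lambda>T. S \<union> T) (random_subset p B))"
  unfolding random_subset_def Pi_pmf_union[OF assms] map_pmf_comp pair_pmf_def
    map_bind_pmf bind_map_pmf map_return_pmf
  unfolding map_pmf_def
  by (intro bind_pmf_cong refl arg_cong[where f = return_pmf]) (use assms in auto)

text \<open>The traces of a random subset on \<open>A\<close> and on \<open>B\<close> are
  independent, so one conditions on the trace \<open>S\<close> on \<open>A\<close>. The event
  \<open>Q\<close> may depend on \<open>S\<close>, as long as the bound \<open>c\<close> is
  uniform.\<close>

lemma prob_random_subset_two_stage:
  assumes fin: "finite A" "finite B" "A \<inter> B = {}" and c: "0 \<le> c"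
    and Q: "\<And>S. S \<subseteq> A \<Longrightarrow> P S \<Longrightarrow> measure_pmf.prob (random_subset p B) {T. Q S T} \<le> c"
  shows "measure_pmf.prob (random_subset p (A \<union> B)) {R. P (R \<inter> A) \<and> Q (R \<inter> A) (R \<inter> B)}
       \<le> measure_pmf.prob (random_subset p A) {S. P S} * c"
proof -
  let ?X = "{R. P (R \<inter> A) \<and> Q (R \<inter> A) (R \<inter> B)}"
  have "emeasure (random_subset p (A \<union> B)) ?X
      = (\<integral>\<^sup>+S. emeasure (random_subset p B) ((\<lambda>T. S \<union> T) -` ?X) \<partial>random_subset p A)"
    by (simp add: random_subset_union[OF fin])
  also have "\<dots> \<le> (\<integral>\<^sup>+S. ennreal c * indicator {S. P S} S \<partial>random_subset p A)"
  proof (rule nn_integral_mono_AE, unfold AE_measure_pmf_iff, rule ballI)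
    fix S assume "S \<in> set_pmf (random_subset p A)"
    then have S: "S \<subseteq> A" using set_pmf_random_subset fin by blast
    have *: "(S \<union> T \<in> ?X) = (P S \<and> Q S T)" if "T \<in> set_pmf (random_subset p B)" for T
    proof -
      have "T \<subseteq> B" using that set_pmf_random_subset fin by blast
      then have "(S \<union> T) \<inter> A = S" "(S \<union> T) \<inter> B = T" using S fin by auto
      then show ?thesis by simp
    qed
    have "emeasure (random_subset p B) ((\<lambda>T. S \<union> T) -` ?X)
        = emeasure (random_subset p B) {T. P S \<and> Q S T}"
      by (rule emeasure_eq_AE) (use * in \<open>auto simp: AE_measure_pmf_iff\<close>)
    also have "\<dots> \<le> ennreal c * indicator {S. P S} S"
    proof (cases "P S")
      case True
      then show ?thesis using Q[OF S True] c
        by (simp add: measure_pmf.emeasure_eq_measure ennreal_leI)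
    qed simp
    finally show "emeasure (random_subset p B) ((\<lambda>T. S \<union> T) -` ?X)
        \<le> ennreal c * indicator {S. P S} S" .
  qed
  also have "\<dots> = ennreal c * emeasure (random_subset p A) {S. P S}"
    by (simp add: nn_integral_cmult)
  finally show ?thesis using c
    by (simp add: measure_pmf.emeasure_eq_measure ennreal_mult[symmetric] mult.commute)
qed

lemma random_subset_restrict:
  assumes "finite A" "B \<subseteq> A"
  shows "random_subset p B = map_pmf (\<lambda>R. R \<inter> B) (random_subset p A)"
  unfolding random_subset_def Pi_pmf_subset[OF assms] map_pmf_comp
  by (intro map_pmf_cong refl) (use assms in auto)

lemma prob_random_subset_restrict:
  assumes "finite A" "B \<subseteq> A"
  shows "measure_pmf.prob (random_subset p A) {R. P (R \<inter> B)}
       = measure_pmf.prob (random_subset p B) {R. P R}"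
  unfolding random_subset_restrict[OF assms] by (simp add: vimage_def)

lemma prob_random_subset_disjnt:
  assumes "finite A" "D \<subseteq> A" "0 \<le> p" "p \<le> 1"
  shows "measure_pmf.prob (random_subset p A) {R. R \<inter> D = {}} = (1 - p) ^ card D"
proof -
  have D: "finite D" using assms finite_subset by blast
  have "measure_pmf.prob (random_subset p A) {R. R \<inter> D = {}}
      = measure_pmf.prob (random_subset p D) {R. R = {}}"
    using prob_random_subset_restrict[OF assms(1,2), of p "\<lambda>R. R = {}"] by simp
  also have "\<dots> = measure_pmf.prob (Pi_pmf D False (\<lambda>_. bernoulli_pmf p)) (Pi D (\<lambda>_. {False}))"
    unfolding random_subset_def
    by (auto simp: vimage_def Pi_def intro!: arg_cong[where f = "measure_pmf.prob _"])
  also have "\<dots> = (1 - p) ^ card D"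
    using assms D by (simp add: measure_Pi_pmf_Pi measure_pmf_single)
  finally show ?thesis .
qed

section \<open>Closing an edge through prescribed random elements\<close>

text \<open>Exposing the \<open>f\<close>-images first: if some \<open>f u\<close> with \<open>u\<close> of degree at least \<open>d\<close> is present,
  then \<open>d\<close> further independent elements have to be absent.\<close>

lemma prob_no_open_edge:
  fixes f :: "'a \<Rightarrow> 'e" and h :: "'b \<Rightarrow> 'e"
  assumes fin: "finite X" "finite Y" and inj: "inj_on h Y" "inj_on f X"
    and disj: "f ` X \<inter> h ` Y = {}" and p: "0 \<le> p" "p \<le> 1"
    and s: "s \<le> card {u\<in>X. d \<le> card {v\<in>Y. g u v}}"
  shows "measure_pmf.prob (random_subset p (f ` X \<union> h ` Y))
      {R. \<not> (\<exists>u\<in>X. \<exists>v\<in>Y. g u v \<and> f u \<in> R \<and> h v \<in> R)}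
    \<le> 1 - (1 - (1 - p) ^ s) * (1 - (1 - p) ^ d)"
proof -
  let ?Xd = "{u\<in>X. d \<le> card {v\<in>Y. g u v}}"
  let ?M = "random_subset p (f ` X \<union> h ` Y)"
  let ?x = "(1 - p) ^ card ?Xd" and ?y = "(1 - p) ^ d"
  let ?P = "\<lambda>S. S \<inter> f ` ?Xd \<noteq> {}"
  let ?Q = "\<lambda>S T. \<forall>u\<in>?Xd. f u \<in> S \<longrightarrow> (\<forall>v\<in>Y. g u v \<longrightarrow> h v \<notin> T)"
  have x: "measure_pmf.prob (random_subset p (f ` X)) {R. R \<inter> f ` ?Xd = {}} = ?x"
    using fin p inj by (subst prob_random_subset_disjnt) (auto simp: card_image inj_on_subset)
  have x': "measure_pmf.prob ?M {R. (R \<inter> f ` X) \<inter> f ` ?Xd = {}} = ?x"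
    using prob_random_subset_restrict[of "f ` X \<union> h ` Y" "f ` X" p "\<lambda>R. R \<inter> f ` ?Xd = {}"] fin x
    by simp
  have Q: "measure_pmf.prob (random_subset p (h ` Y)) {T. ?Q S T} \<le> ?y" if S: "?P S" for S
  proof -
    obtain u where u: "u \<in> ?Xd" "f u \<in> S" using S by blast
    have "measure_pmf.prob (random_subset p (h ` Y)) {T. ?Q S T}
        \<le> measure_pmf.prob (random_subset p (h ` Y)) {T. T \<inter> h ` {v\<in>Y. g u v} = {}}"
      by (rule measure_pmf.finite_measure_mono) (use u in auto)
    also have "\<dots> = (1 - p) ^ card {v\<in>Y. g u v}"
      using fin p inj by (subst prob_random_subset_disjnt) (auto simp: card_image inj_on_subset)
    also have "\<dots> \<le> ?y" using u p by (intro power_decreasing) auto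
    finally show ?thesis .
  qed
  \<comment> \<open>Failure has two causes: no \<open>f u\<close> with \<open>u\<close> in
    \<open>?Xd\<close> is present, or one is present and all its partners \<open>h v\<close> are
    absent. This gives the bound \<open>?x + (1 - ?x) * ?y\<close>.\<close>
  have "measure_pmf.prob ?M {R. \<not> (\<exists>u\<in>X. \<exists>v\<in>Y. g u v \<and> f u \<in> R \<and> h v \<in> R)}
      \<le> measure_pmf.prob ?M ({R. (R \<inter> f ` X) \<inter> f ` ?Xd = {}} \<union>
           {R. ?P (R \<inter> f ` X) \<and> ?Q (R \<inter> f ` X) (R \<inter> h ` Y)})"
    by (rule measure_pmf.finite_measure_mono) auto
  also have "\<dots> \<le> measure_pmf.prob ?M {R. (R \<inter> f ` X) \<inter> f ` ?Xd = {}} +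
      measure_pmf.prob ?M {R. ?P (R \<inter> f ` X) \<and> ?Q (R \<inter> f ` X) (R \<inter> h ` Y)}"
    by (rule measure_Un_le) auto
  also have "measure_pmf.prob ?M {R. ?P (R \<inter> f ` X) \<and> ?Q (R \<inter> f ` X) (R \<inter> h ` Y)}
      \<le> measure_pmf.prob (random_subset p (f ` X)) {S. ?P S} * ?y"
    by (rule prob_random_subset_two_stage) (use fin disj p Q in auto)
  also have "measure_pmf.prob (random_subset p (f ` X)) {S. ?P S} = 1 - ?x"
  proof -
    have "{S. ?P S} = space (measure_pmf (random_subset p (f ` X))) - {S. S \<inter> f ` ?Xd = {}}"
      by auto
    then show ?thesis using x
      by (metis (mono_tags, lifting) measure_pmf.prob_compl sets_measure_pmf UNIV_I)
  qed
  finally have "measure_pmf.prob ?M {R. \<not> (\<exists>u\<in>X. \<exists>v\<in>Y. g u v \<and> f u \<in> R \<and> h v \<in> R)}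
      \<le> 1 - (1 - ?x) * (1 - ?y)"
    using x' by (simp add: algebra_simps)
  also have "\<dots> \<le> 1 - (1 - (1 - p) ^ s) * (1 - ?y)"
    using p s by (intro diff_left_mono mult_right_mono) (auto intro!: power_decreasing power_le_one)
  finally show ?thesis .
qed

text \<open>The events for distinct \<open>j\<close> depend on disjoint sets \<open>D j\<close> and
  are independent, so the failure bounds multiply; the induction exposes the first \<open>i\<close>
  sets and then \<open>D i\<close>.\<close>

lemma prob_no_open_edge_family:
  fixes f :: "nat \<Rightarrow> 'a \<Rightarrow> 'e" and h :: "nat \<Rightarrow> 'b \<Rightarrow> 'e"
    and X :: "'a set" and Y :: "'b set" and k :: nat
  defines "D \<equiv> \<lambda>j. f j ` X \<union> h j ` Y"
  assumes fin: "finite X" "finite Y"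
    and inj: "\<And>j. j < k \<Longrightarrow> inj_on (f j) X" "\<And>j. j < k \<Longrightarrow> inj_on (h j) Y"
    and disj: "\<And>j. j < k \<Longrightarrow> f j ` X \<inter> h j ` Y = {}"
      "\<And>i j. i < k \<Longrightarrow> j < k \<Longrightarrow> i \<noteq> j \<Longrightarrow> D i \<inter> D j = {}"
    and p: "0 \<le> p" "p \<le> 1"
    and s: "s \<le> card {u\<in>X. d \<le> card {v\<in>Y. g u v}}"
    and A: "finite A" "(\<Union>j<k. D j) \<subseteq> A"
  shows "measure_pmf.prob (random_subset p A)
      {R. \<forall>j<k. \<not> (\<exists>u\<in>X. \<exists>v\<in>Y. g u v \<and> f j u \<in> R \<and> h j v \<in> R)}
    \<le> (1 - (1 - (1 - p) ^ s) * (1 - (1 - p) ^ d)) ^ k"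
proof -
  let ?q = "1 - (1 - (1 - p) ^ s) * (1 - (1 - p) ^ d)"
  define F where "F j R \<longleftrightarrow> (\<exists>u\<in>X. \<exists>v\<in>Y. g u v \<and> f j u \<in> R \<and> h j v \<in> R)" for j R
  have q: "0 \<le> ?q"
    using p mult_le_one[of "1 - (1 - p) ^ s" "1 - (1 - p) ^ d"] by (simp add: power_le_one)
  have F_Int: "F j (R \<inter> B) \<longleftrightarrow> F j R" if "D j \<subseteq> B" for j R B
  proof -
    have "f j u \<in> B" if "u \<in> X" for u using that \<open>D j \<subseteq> B\<close> by (auto simp: D_def)
    moreover have "h j v \<in> B" if "v \<in> Y" for v using that \<open>D j \<subseteq> B\<close> by (auto simp: D_def)
    ultimately show ?thesis by (auto simp: F_def)
  qed
  have "measure_pmf.prob (random_subset p (\<Union>j<i. D j)) {R. \<forall>j<i. \<not> F j R} \<le> ?q ^ i"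
    if "i \<le> k" for i
    using that
  proof (induction i)
    case (Suc i)
    let ?A = "\<Union>j<i. D j"
    have fA: "finite ?A" "finite (D i)" using fin by (auto simp: D_def)
    have "D j \<inter> D i = {}" if "j < i" for j using disj(2)[of j i] that Suc.prems by simp
    then have dA: "?A \<inter> D i = {}" by blast
    have eq: "(\<Union>j<Suc i. D j) = ?A \<union> D i" by (auto simp: less_Suc_eq)
    have F1: "F j (R \<inter> ?A) = F j R" if "j < i" for j R using that by (intro F_Int) auto
    have F2: "F i (R \<inter> D i) = F i R" for R by (intro F_Int) auto
    have "{R. \<forall>j<Suc i. \<not> F j R} = {R. (\<forall>j<i. \<not> F j (R \<inter> ?A)) \<and> \<not> F i (R \<inter> D i)}"
      by (simp add: F1 F2 All_less_Suc conj_commute cong: conj_cong)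
    then have "measure_pmf.prob (random_subset p (\<Union>j<Suc i. D j)) {R. \<forall>j<Suc i. \<not> F j R}
        = measure_pmf.prob (random_subset p (?A \<union> D i))
            {R. (\<forall>j<i. \<not> F j (R \<inter> ?A)) \<and> \<not> F i (R \<inter> D i)}"
      using eq by simp
    also have "\<dots> \<le> measure_pmf.prob (random_subset p ?A) {R. \<forall>j<i. \<not> F j R} * ?q"
    proof (rule prob_random_subset_two_stage[OF fA dA q])
      show "measure_pmf.prob (random_subset p (D i)) {T. \<not> F i T} \<le> ?q"
        unfolding D_def F_def
        by (rule prob_no_open_edge) (use fin inj disj(1) p s Suc.prems in auto)
    qed
    also have "\<dots> \<le> ?q ^ i * ?q" using Suc q by (intro mult_right_mono) auto
    finally show ?case by (simp only: power_Suc mult.commute)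
  qed simp
  \<comment> \<open>\<open>A\<close> may have elements outside all \<open>D j\<close>; restriction
    discards them.\<close>
  from this[of k] have "measure_pmf.prob (random_subset p A)
      {R. \<forall>j<k. \<not> F j (R \<inter> (\<Union>j<k. D j))} \<le> ?q ^ k"
    using prob_random_subset_restrict[OF A, of p "\<lambda>R. \<forall>j<k. \<not> F j R"] by simp
  moreover have F': "F j (R \<inter> (\<Union>j<k. D j)) = F j R" if "j < k" for j R
    using that by (intro F_Int) auto
  have "{R. \<forall>j<k. \<not> F j (R \<inter> (\<Union>j<k. D j))} = {R. \<forall>j<k. \<not> F j R}"
    by (simp only: F' cong: imp_cong)
  ultimately show ?thesis by (simp only: F_def)
qed

section \<open>Degree levels\<close>

lemma one_minus_power_le_exp:
  fixes p :: real
  assumes "p \<le> 1"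
  shows "(1 - p) ^ k \<le> exp (- (p * real k))"
proof -
  have "(1 - p) ^ k \<le> exp (- p) ^ k"
    using assms exp_ge_add_one_self[of "-p"] by (intro power_mono) auto
  also have "\<dots> = exp (- (p * real k))" by (simp add: exp_of_nat_mult[symmetric] mult.commute)
  finally show ?thesis .
qed

lemma half_le_one_minus_exp:
  fixes x :: real
  assumes "0 \<le> x" "x \<le> 1"
  shows "x / 2 \<le> 1 - exp (- x)"
proof -
  have "exp (- x) \<le> inverse (1 + x)"
    using assms exp_ge_add_one_self[of x] by (auto simp: exp_minus intro!: le_imp_inverse_le)
  also have "\<dots> \<le> 1 - x / 2"
    using assms mult_left_mono[of x 1 x] by (simp add: field_simps)
  finally show ?thesis by simp
qed

text \<open>Turns a union bound over two events of probability \<open>exp (- t)\<close> into a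
  single exponential; \<open>ln 2 \<le> 3 / 4\<close> pays for the factor 2.\<close>

lemma two_exp_le:
  fixes t :: real
  assumes "1 \<le> t"
  shows "2 * exp (- t) \<le> exp (- (t / 4))"
proof -
  have "ln 2 \<le> (3 / 4 :: real)" using ln2_le_25_over_36 by simp
  then have "exp (ln 2) \<le> exp (3 / 4 :: real)" by (simp only: exp_le_cancel_iff)
  then have "2 \<le> exp (3 / 4 :: real)" by simp
  also have "\<dots> \<le> exp (3 * t / 4)" using assms by simp
  finally have "2 * exp (- t) \<le> exp (3 * t / 4) * exp (- t)" by simp
  also have "\<dots> = exp (- (t / 4))" by (simp add: exp_add[symmetric])
  finally show ?thesis .
qed

lemma harm_le_one_plus_ln: "1 \<le> n \<Longrightarrow> (harm n :: real) \<le> 1 + ln (real n)"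
  using euler_mascheroni_sequence_decreasing[of 1 n] by (simp add: harm_expand)

text \<open>If every level were lighter, level \<open>i\<close> would have size below a constant
  over \<open>i\<close>, and summing over \<open>1..n\<close> would bound the degree sum strictly by
  itself times \<open>harm n / (1 + ln (real n))\<close>, a factor of at most 1.\<close>

lemma exists_heavy_level:
  fixes d :: "'a \<Rightarrow> nat"
  assumes "finite M" "\<And>u. u \<in> M \<Longrightarrow> d u \<le> n" "1 \<le> n"
  shows "\<exists>i\<ge>1. real (\<Sum>u\<in>M. d u) \<le> real i * real (card {u\<in>M. i \<le> d u}) * (1 + ln (real n))"
proof (rule ccontr)
  let ?S = "real (\<Sum>u\<in>M. d u)" and ?N = "\<lambda>i. card {u\<in>M. i \<le> d u}"
  let ?L = "1 + ln (real n)"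
  assume neg: "\<not> ?thesis"
  have L: "?L > 0" using assms(3) by (simp add: add_pos_nonneg)
  have lt: "real (?N i) < ?S / ?L * inverse (real i)" if "1 \<le> i" for i
  proof -
    have "real i * real (?N i) * ?L < ?S" using neg that by auto
    then have "real (?N i) * (?L * real i) < ?S" by (simp only: mult_ac)
    then have "real (?N i) < ?S / (?L * real i)"
      using L that by (subst pos_less_divide_eq) auto
    then show ?thesis by (simp only: divide_inverse inverse_mult_distrib mult.assoc)
  qed
  have "d u = (\<Sum>i=1..n. of_bool (i \<le> d u))" if "u \<in> M" for u
  proof -
    have "{1..n} \<inter> {i. i \<le> d u} = {1..d u}" using assms(2)[OF that] by auto
    then show ?thesis by simp
  qed
  then have "(\<Sum>u\<in>M. d u) = (\<Sum>u\<in>M. \<Sum>i=1..n. of_bool (i \<le> d u))" by simp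
  also have "\<dots> = (\<Sum>i=1..n. ?N i)"
    using assms(1) by (subst sum.swap) (simp add: Collect_conj_eq)
  finally have "?S = (\<Sum>i=1..n. real (?N i))" by simp
  also have "\<dots> < (\<Sum>i=1..n. ?S / ?L * inverse (real i))"
    using assms(3) by (intro sum_strict_mono lt) auto
  also have "\<dots> = ?S / ?L * harm n" by (simp add: harm_def sum_distrib_left)
  also have "\<dots> \<le> ?S / ?L * ?L"
    using harm_le_one_plus_ln[OF assms(3)] L
    by (intro mult_left_mono divide_nonneg_pos of_nat_0_le_iff)
  finally show False using L by simp
qed

lemma one_minus_mult_mono:
  fixes a b x y :: real
  assumes "0 \<le> a" "0 \<le> b" "a \<le> 1 - x" "b \<le> 1 - y"
  shows "1 - (1 - x) * (1 - y) \<le> 1 - a * b"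
  using mult_mono[OF assms(3,4)] assms by simp

text \<open>Vertices of degree at least \<open>max (1/p) (m/64)\<close> are hubs. If there are at least \<open>m/64\<close> of
  them, the hubs alone suffice; otherwise a positive fraction of the edges sits at vertices of
  degree between \<open>m/64\<close> and \<open>1/p\<close>. The logarithm lost by passing to a single degree level is
  compensated by \<open>ln n \<le> p * n\<close>.\<close>

lemma exists_degree_level:
  fixes d :: "'a \<Rightarrow> nat" and p :: real and n m :: nat
  assumes X: "finite X" "card X \<le> n" and d: "\<And>u. u \<in> X \<Longrightarrow> d u \<le> n" and m: "1 \<le> m"
    and n: "1 \<le> ln (real n)" and p: "0 < p" "p \<le> 1" "ln (real n) \<le> p * real n"
    and sum: "real n * real m / 16 \<le> real (\<Sum>u\<in>X. d u)"
  shows "\<exists>s k. s \<le> card {u\<in>X. k \<le> d u} \<and>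
    1 - (1 - (1 - p) ^ s) * (1 - (1 - p) ^ k) \<le> exp (- (p * real m / 256))"
proof -
  \<comment> \<open>In these terms \<open>n * m / 16\<close> is \<open>4 * n * r\<close>: degrees
    below \<open>r\<close> contribute at most \<open>n * r\<close>, and so do fewer than
    \<open>r\<close> hubs, which leaves \<open>2 * n * r\<close> for the middle range.\<close>
  define r where "r = real m / 64"
  define t where "t = p * r"
  define D where "D = max (1 / p) r"
  define hi where "hi = {u\<in>X. D \<le> real (d u)}"
  define mid where "mid = {u\<in>X. r \<le> real (d u) \<and> real (d u) < D}"
  have n0: "0 < real n" and n1: "1 \<le> n"
    using n by (cases "n = 0"; simp)+
  have r0: "0 < r" and t0: "0 < t" using m p by (auto simp: r_def t_def)
  have goal: "exp (- (t / 4)) = exp (- (p * real m / 256))" by (simp add: t_def r_def)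
  have fin: "finite hi" "finite mid" using X by (auto simp: hi_def mid_def)
  have pd: "1 - exp (- (p * real k)) \<le> 1 - (1 - p) ^ k" for k
    using one_minus_power_le_exp[OF p(2)] by simp
  show ?thesis
  proof (cases "r \<le> real (card hi)")
    case True
    define k where "k = nat \<lceil>D\<rceil>"
    have kD: "D \<le> real k" unfolding k_def by linarith
    have hi: "hi = {u\<in>X. k \<le> d u}"
      unfolding hi_def k_def by (auto simp: nat_le_iff ceiling_le_iff)
    have "t \<le> p * real (card hi)" using True p by (simp add: t_def)
    then have a: "1 - exp (- t) \<le> 1 - (1 - p) ^ card hi"
      using pd[of "card hi"] by (smt (verit) exp_le_cancel_iff)
    have "max 1 t = p * D"
      using p by (simp add: D_def t_def max_mult_distrib_left)
    also have "\<dots> \<le> p * real k" using kD p by simp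
    finally have b: "1 - exp (- max 1 t) \<le> 1 - (1 - p) ^ k"
      using pd[of k] by (smt (verit) exp_le_cancel_iff)
    have "1 - (1 - (1 - p) ^ card hi) * (1 - (1 - p) ^ k) \<le>
        1 - (1 - exp (- t)) * (1 - exp (- max 1 t))"
      using a b t0 by (intro one_minus_mult_mono) auto
    also have "\<dots> \<le> exp (- (t / 4))"
    \<comment> \<open>For \<open>t \<ge> 1\<close> both exponentials equal \<open>exp (- t)\<close>;
      for \<open>t < 1\<close> the two factors are at least \<open>t / 2\<close> and
      \<open>1 / 2\<close>.\<close>
    proof (cases "1 \<le> t")
      case True
      then have "1 - (1 - exp (- t)) * (1 - exp (- max 1 t)) \<le> 2 * exp (- t)"
        by (simp add: max_def algebra_simps)
      then show ?thesis using two_exp_le[OF True] by linarith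
    next
      case False
      then have "1 - (1 - exp (- t)) * (1 - exp (- max 1 t)) \<le> 1 - (t / 2) * (1 / 2)"
        using half_le_one_minus_exp[of t] half_le_one_minus_exp[of 1] t0
        by (intro one_minus_mult_mono) (auto simp: max_def)
      also have "\<dots> \<le> exp (- (t / 4))" using exp_ge_add_one_self[of "- (t / 4)"] by simp
      finally show ?thesis .
    qed
    finally show ?thesis using goal hi by (metis order_refl)
  next
    case False
    have "real (\<Sum>u\<in>X. d u) \<le>
      (\<Sum>u\<in>X. r + (if u \<in> hi then real n else 0) + (if u \<in> mid then real (d u) else 0))"
      unfolding of_nat_sum
    proof (rule sum_mono)
      fix u assume "u \<in> X"
      then show "real (d u) \<le>
          r + (if u \<in> hi then real n else 0) + (if u \<in> mid then real (d u) else 0)"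
        using d[of u] r0 by (auto simp: hi_def mid_def)
    qed
    also have "\<dots> = real (card X) * r + real (card hi) * real n + real (\<Sum>u\<in>mid. d u)"
    proof -
      have "X \<inter> hi = hi" "X \<inter> mid = mid" by (auto simp: hi_def mid_def)
      then show ?thesis using X by (simp add: sum.distrib sum.If_cases)
    qed
    also have "\<dots> \<le> real n * r + r * real n + real (\<Sum>u\<in>mid. d u)"
      using X False r0 by (intro add_mono mult_right_mono) auto
    finally have mid_sum: "2 * real n * r \<le> real (\<Sum>u\<in>mid. d u)"
      using sum by (simp add: r_def field_simps)
    have "0 < 2 * real n * r" using n0 r0 by simp
    with mid_sum have "mid \<noteq> {}" by (metis of_nat_0 order_less_le_trans less_irrefl sum.empty)
    \<comment> \<open>A vertex in the middle range shows \<open>r < D\<close>, so the maximum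
      defining \<open>D\<close> is \<open>1 / p\<close>.\<close>
    then have rD: "r < D" by (auto simp: mid_def)
    then have D: "D = 1 / p" by (auto simp: D_def max_def split: if_splits)
    have "mid \<subseteq> X" by (auto simp: mid_def)
    then obtain i where i: "1 \<le> i" "real (\<Sum>u\<in>mid. d u) \<le>
        real i * real (card {u\<in>mid. i \<le> d u}) * (1 + ln (real n))"
      using exists_heavy_level[of mid d n] d fin n1 by blast
    \<comment> \<open>Degrees in \<open>mid\<close> are at least \<open>r\<close>, so raising the
      level to \<open>r\<close> keeps the same vertices while ensuring
      \<open>r \<le> k\<close>.\<close>
    define k where "k = max i (nat \<lceil>r\<rceil>)"
    define s where "s = card {u\<in>mid. k \<le> d u}"
    have s: "s = card {u\<in>mid. i \<le> d u}"
      unfolding s_def k_def by (rule arg_cong[where f = card]) (auto simp: mid_def nat_le_iff ceiling_le_iff)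
    have rk: "r \<le> real k" unfolding k_def by linarith
    have "2 * real n * r \<le> real i * real s * (1 + ln (real n))"
      using order_trans[OF mid_sum i(2)] s by simp
    also have "\<dots> \<le> real k * real s * (2 * (p * real n))"
      using n p by (intro mult_mono) (auto simp: k_def)
    finally have ks: "r \<le> p * real k * real s" using n0 by (simp add: field_simps)
    then have "s \<noteq> 0" using r0 by (intro notI) simp
    \<comment> \<open>Some middle vertex reaches level \<open>k\<close> and has degree below
      \<open>1 / p\<close>; hence \<open>p * k \<le> 1\<close>, the range where
      \<open>1 - exp (- x) \<ge> x / 2\<close> is available.\<close>
    then obtain u where "u \<in> mid" "k \<le> d u" unfolding s_def by (metis (mono_tags, lifting) card.empty empty_Collect_eq)
    then have "real k < 1 / p" using D by (auto simp: mid_def)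
    then have pk: "p * real k \<le> 1" using p by (simp add: field_simps)
    have b: "p * real k / 2 \<le> 1 - (1 - p) ^ k"
      using half_le_one_minus_exp[of "p * real k"] pd[of k] pk p by fastforce
    have a: "min 1 (p * real s) / 2 \<le> 1 - (1 - p) ^ s"
    proof -
      have "min 1 (p * real s) / 2 \<le> 1 - exp (- min 1 (p * real s))"
        using p by (intro half_le_one_minus_exp) auto
      also have "\<dots> \<le> 1 - exp (- (p * real s))" by simp
      finally show ?thesis using pd[of s] by linarith
    qed
    \<comment> \<open>If \<open>p * s \<ge> 1\<close>, this is \<open>r \<le> k\<close>; otherwise
      it is \<open>r \<le> p * k * s\<close>.\<close>
    have "t \<le> min 1 (p * real s) * (p * real k)"
    proof (cases "1 \<le> p * real s")
      case True
      then show ?thesis using rk p by (simp add: t_def min_def)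
    next
      case False
      have "t \<le> p * (p * real k * real s)" using ks p by (simp add: t_def)
      then show ?thesis using False by (simp add: min_def mult_ac)
    qed
    then have "1 - (1 - (1 - p) ^ s) * (1 - (1 - p) ^ k) \<le> 1 - t / 4"
      using one_minus_mult_mono[OF _ _ a b] p by simp
    also have "\<dots> \<le> exp (- (t / 4))" using exp_ge_add_one_self[of "- (t / 4)"] by simp
    finally have "1 - (1 - (1 - p) ^ s) * (1 - (1 - p) ^ k) \<le> exp (- (t / 4))" .
    moreover have "s \<le> card {u\<in>X. k \<le> d u}"
      unfolding s_def by (rule card_mono) (use X in \<open>auto simp: mid_def\<close>)
    ultimately show ?thesis using goal by metis
  qed
qed

section \<open>Paths and cuts\<close>

text \<open>\<open>P\<close> takes the index because the final selection mixes two kinds of cycles: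
  first those off the hubs, then one through each chosen hub.\<close>

lemma greedy_disjoint:
  fixes m :: nat and P :: "nat \<Rightarrow> 'f \<Rightarrow> bool" and S :: "'f \<Rightarrow> 'a set"
  assumes step: "\<And>i F. i < m \<Longrightarrow> (\<forall>j<i. P j (F j)) \<Longrightarrow> \<exists>f. P i f \<and> (\<forall>j<i. S (F j) \<inter> S f = {})"
  shows "\<exists>F. (\<forall>i<m. P i (F i)) \<and> (\<forall>i<m. \<forall>j<m. i \<noteq> j \<longrightarrow> S (F i) \<inter> S (F j) = {})"
  using step
proof (induction m)
  case (Suc m)
  then obtain F where F: "\<forall>i<m. P i (F i)" "\<forall>i<m. \<forall>j<m. i \<noteq> j \<longrightarrow> S (F i) \<inter> S (F j) = {}"
    by (metis less_SucI)
  obtain f where f: "P m f" "\<forall>j<m. S (F j) \<inter> S f = {}"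
    using Suc.prems[of m F] F by auto
  let ?F = "F(m := f)"
  have "\<forall>i<Suc m. P i (?F i)" using F f by (simp add: less_Suc_eq)
  moreover have "\<forall>i<Suc m. \<forall>j<Suc m. i \<noteq> j \<longrightarrow> S (?F i) \<inter> S (?F j) = {}"
    using F(2) f(2) by (auto simp: less_Suc_eq Int_commute)
  ultimately show ?case by blast
qed simp

section \<open>Paths in graphs without bipartite holes\<close>

text \<open>Known as the absence of a bipartite hole with both sides of size
  \<open>s\<close>.\<close>

definition joined :: "nat \<Rightarrow> 'a set \<Rightarrow> 'a set set \<Rightarrow> bool" where
  "joined s V R \<longleftrightarrow> (\<forall>A B. A \<subseteq> V \<longrightarrow> B \<subseteq> V \<longrightarrow> card A = s \<longrightarrow> card B = s \<longrightarrow> A \<inter> B = {} \<longrightarrow>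
     (\<exists>a\<in>A. \<exists>b\<in>B. {a, b} \<in> R))"

definition path_in :: "'a set set \<Rightarrow> 'a list \<Rightarrow> bool" where
  "path_in R xs \<longleftrightarrow> distinct xs \<and> successively (\<lambda>a b. {a, b} \<in> R) xs"

text \<open>Keeping \<open>s\<close> possible heads instead of one carries the induction: of
  \<open>2 * s\<close> vertices set aside, fewer than \<open>s\<close> miss all current heads, since
  \<open>s\<close> of them would contradict \<open>joined\<close>; the others prolong a path by one
  vertex.\<close>

lemma joined_path_ends:
  assumes J: "joined s V R" and "1 \<le> s" "1 \<le> t" "finite A" "A \<subseteq> V" "2 * s * t \<le> card A"
  shows "\<exists>E\<subseteq>A. card E = s \<and> (\<forall>e\<in>E. \<exists>xs. path_in R xs \<and> length xs = t \<and> set xs \<subseteq> A \<and> hd xs = e)"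
  using assms(3-6)
proof (induction t arbitrary: A rule: dec_induct)
  case base
  then obtain E where E: "E \<subseteq> A" "card E = s"
    using obtain_subset_with_card_n[of s A] assms(2) by auto
  have "path_in R [e] \<and> length [e] = 1 \<and> set [e] \<subseteq> A \<and> hd [e] = e" if "e \<in> E" for e
    using that E by (auto simp: path_in_def)
  with E show ?case by metis
next
  case (step t)
  have "2 * s \<le> card A" using step.prems by simp
  then obtain B where B: "B \<subseteq> A" "card B = 2 * s" "finite B"
    using obtain_subset_with_card_n by blast
  have cA: "2 * s * t \<le> card (A - B)"
    using B step.prems by (simp add: card_Diff_subset)
  obtain E where E: "E \<subseteq> A - B" "card E = s"
    "\<And>e. e \<in> E \<Longrightarrow> \<exists>xs. path_in R xs \<and> length xs = t \<and> set xs \<subseteq> A - B \<and> hd xs = e"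
    using step.IH[of "A - B"] cA step.prems by blast
  define N where "N = {b\<in>B. \<exists>e\<in>E. {b, e} \<in> R}"
  have "s \<le> card N"
  proof (rule ccontr)
    assume "\<not> s \<le> card N"
    then have "s \<le> card (B - N)"
      using B by (subst card_Diff_subset) (auto simp: N_def)
    then obtain C where C: "C \<subseteq> B - N" "card C = s"
      using obtain_subset_with_card_n by blast
    have "\<exists>a\<in>C. \<exists>b\<in>E. {a, b} \<in> R"
    proof -
      have "C \<subseteq> V" "E \<subseteq> V" "C \<inter> E = {}" using C E B step.prems by auto
      then show ?thesis using J C(2) E(2) unfolding joined_def by blast
    qed
    then show False using C by (auto simp: N_def)
  qed
  then obtain N' where N': "N' \<subseteq> N" "card N' = s"
    using obtain_subset_with_card_n by blast
  have "\<exists>xs. path_in R xs \<and> length xs = Suc t \<and> set xs \<subseteq> A \<and> hd xs = b" if "b \<in> N'" for b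
  proof -
    obtain e where e: "b \<in> B" "e \<in> E" "{b, e} \<in> R"
      using \<open>b \<in> N'\<close> N' by (auto simp: N_def)
    obtain xs where xs: "path_in R xs" "length xs = t" "set xs \<subseteq> A - B" "hd xs = e"
      using E(3) e by blast
    have "path_in R (b # xs)"
      using xs e by (auto simp: path_in_def successively_Cons)
    then show ?thesis using xs e B by (intro exI[of _ "b # xs"]) auto
  qed
  moreover have "N' \<subseteq> A" using N' B by (auto simp: N_def)
  ultimately show ?case using N' by blast
qed

lemma joined_path:
  assumes "joined s V R" "1 \<le> s" "1 \<le> t" "finite A" "A \<subseteq> V" "2 * s * t \<le> card A"
  obtains xs where "path_in R xs" "length xs = t" "set xs \<subseteq> A"
proof -
  obtain E where E: "card E = s"
    "\<forall>e\<in>E. \<exists>xs. path_in R xs \<and> length xs = t \<and> set xs \<subseteq> A \<and> hd xs = e"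
    using joined_path_ends[OF assms] by blast
  then have "E \<noteq> {}" using assms(2) by auto
  then show ?thesis using E that by blast
qed

text \<open>Earlier paths occupy at most \<open>k * t\<close> vertices, so \<open>2 * s * t\<close>
  vertices of \<open>A\<close> stay free for the next one.\<close>

lemma joined_disjoint_paths:
  assumes J: "joined s V R" "1 \<le> s" "1 \<le> t" "finite A" "A \<subseteq> V" "2 * s * t + k * t \<le> card A"
  shows "\<exists>ps. (\<forall>j<k. path_in R (ps j) \<and> length (ps j) = t \<and> set (ps j) \<subseteq> A) \<and>
    (\<forall>i<k. \<forall>j<k. i \<noteq> j \<longrightarrow> set (ps i) \<inter> set (ps j) = {})"
proof (rule greedy_disjoint)
  fix i and F :: "nat \<Rightarrow> 'a list"
  assume i: "i < k" "\<forall>j<i. path_in R (F j) \<and> length (F j) = t \<and> set (F j) \<subseteq> A"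
  let ?U = "\<Union>j<i. set (F j)"
  have "card ?U \<le> (\<Sum>j<i. card (set (F j)))" by (rule card_UN_le) simp
  also have "\<dots> \<le> (\<Sum>j<i. t)" using i by (intro sum_mono) (metis card_length lessThan_iff)
  also have "\<dots> \<le> k * t" using i by simp
  finally have U: "card ?U \<le> k * t" .
  have "?U \<subseteq> A" using i by auto
  then have "2 * s * t \<le> card (A - ?U)"
    using U J by (subst card_Diff_subset) auto
  then obtain xs where "path_in R xs" "length xs = t" "set xs \<subseteq> A - ?U"
    using joined_path[of s V R t "A - ?U"] J by blast
  then show "\<exists>f. (path_in R f \<and> length f = t \<and> set f \<subseteq> A) \<and> (\<forall>j<i. set (F j) \<inter> set f = {})"
    by (intro exI[of _ xs]) auto
qed

text \<open>The positions in \<open>v # xs\<close> run once around the cycle; only the wrap from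
  \<open>l - 1\<close> to \<open>0\<close> uses the closing edge.\<close>

lemma cycle_copy_of_path:
  assumes path: "path_in E (v # xs)" and len: "length xs = l - 1" "2 \<le> l"
    and close: "{last xs, v} \<in> E" and n: "set (v # xs) \<subseteq> {..<n}"
  shows "\<exists>f. cycle_copy n E l f \<and> f ` {..<l} = set (v # xs)"
proof -
  let ?f = "(!) (v # xs)"
  have l: "length (v # xs) = l" using len by simp
  have img: "?f ` {..<l} = set (v # xs)" using l nth_image[of l "v # xs"] by (simp add: lessThan_atLeast0)
  have "inj_on ?f {..<l}" using path l by (simp add: path_in_def inj_on_nth)
  moreover have "{?f i, ?f (Suc i mod l)} \<in> E" if "i < l" for i
  proof (cases "Suc i < l")
    case True
    then show ?thesis using path l unfolding path_in_def by (metis mod_less successively_conv_nth)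
  next
    case False
    then have i: "Suc i = l" using that by simp
    have "xs \<noteq> []" using len by auto
    have "i - 1 = length xs - 1" "i \<noteq> 0" using i len by auto
    then have "?f i = xs ! (length xs - 1)" by (simp add: nth_Cons')
    also have "\<dots> = last xs" using \<open>xs \<noteq> []\<close> by (simp add: last_conv_nth)
    finally have "?f i = last xs" .
    then show ?thesis using i close by simp
  qed
  ultimately show ?thesis using img n unfolding cycle_copy_def by blast
qed

section \<open>Edge counts and cuts\<close>

text \<open>Ordered pairs are counted: for symmetric loopless \<open>g\<close>,
  \<open>edge_count g V V\<close> is twice the number of edges, while disjoint \<open>P\<close> and
  \<open>Q\<close> see each crossing edge once.\<close>

definition edge_count :: "('a \<Rightarrow> 'a \<Rightarrow> bool) \<Rightarrow> 'a set \<Rightarrow> 'a set \<Rightarrow> nat" where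
  "edge_count g P Q = (\<Sum>u\<in>P. \<Sum>v\<in>Q. of_bool (g u v))"

lemma edge_count_eq_sum_card:
  "finite Q \<Longrightarrow> edge_count g P Q = (\<Sum>u\<in>P. card {v\<in>Q. g u v})"
  by (simp add: edge_count_def Collect_conj_eq)

lemma edge_count_commute: "(\<And>u v. g u v \<longleftrightarrow> g v u) \<Longrightarrow> edge_count g P Q = edge_count g Q P"
  unfolding edge_count_def by (subst sum.swap) simp

lemma edge_count_Un_left:
  "finite P \<Longrightarrow> finite P' \<Longrightarrow> P \<inter> P' = {} \<Longrightarrow>
    edge_count g (P \<union> P') Q = edge_count g P Q + edge_count g P' Q"
  by (simp add: edge_count_def sum.union_disjoint)

lemma edge_count_Un_right:
  "finite Q \<Longrightarrow> finite Q' \<Longrightarrow> Q \<inter> Q' = {} \<Longrightarrow>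
    edge_count g P (Q \<union> Q') = edge_count g P Q + edge_count g P Q'"
  by (simp add: edge_count_def sum.union_disjoint sum.distrib del: sum_of_bool_eq)

text \<open>Each new vertex goes opposite to the side with more of its neighbours, so at least half
  of the edges cross; the factor is 4 because \<open>edge_count g V V\<close> sees every edge
  twice.\<close>

lemma max_cut:
  assumes "finite V" and sym: "\<And>u v. g u v \<longleftrightarrow> g v u" and irr: "\<And>u. \<not> g u u"
  shows "\<exists>P Q. P \<union> Q = V \<and> P \<inter> Q = {} \<and> edge_count g V V \<le> 4 * edge_count g P Q"
  using assms(1)
proof (induction rule: finite_induct)
  case empty
  then show ?case by (simp add: edge_count_def)
next
  case (insert x V)
  then obtain P Q where PQ: "P \<union> Q = V" "P \<inter> Q = {}" "edge_count g V V \<le> 4 * edge_count g P Q"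
    by blast
  have fin: "finite P" "finite Q" using PQ insert by auto
  have x: "x \<notin> P" "x \<notin> Q" using PQ insert by auto
  have "edge_count g (insert x V) (insert x V) = edge_count g V V + 2 * edge_count g V {x}"
    using insert edge_count_Un_left[of V "{x}" g "V \<union> {x}"] edge_count_Un_right[of V "{x}" g V]
      edge_count_Un_right[of V "{x}" g "{x}"] edge_count_commute[of g "{x}" V, OF sym] irr
    by (simp add: edge_count_def)
  also have "edge_count g V {x} = edge_count g P {x} + edge_count g Q {x}"
    using PQ fin edge_count_Un_left[of P Q g "{x}"] by simp
  finally have *: "edge_count g (insert x V) (insert x V) \<le>
      4 * edge_count g P Q + 2 * (edge_count g P {x} + edge_count g Q {x})"
    using PQ by simp
  show ?case
  proof (cases "edge_count g Q {x} \<le> edge_count g P {x}")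
    case True
    have "edge_count g P (insert x Q) = edge_count g P Q + edge_count g P {x}"
      using edge_count_Un_right[of Q "{x}" g P] fin x by simp
    with * True have "edge_count g (insert x V) (insert x V) \<le> 4 * edge_count g P (insert x Q)"
      by simp
    moreover have "P \<union> insert x Q = insert x V" "P \<inter> insert x Q = {}" using PQ x by auto
    ultimately show ?thesis by blast
  next
    case False
    have "edge_count g (insert x P) Q = edge_count g P Q + edge_count g Q {x}"
      using edge_count_Un_left[of P "{x}" g Q] fin x edge_count_commute[of g "{x}" Q, OF sym] by simp
    with * False have "edge_count g (insert x V) (insert x V) \<le> 4 * edge_count g (insert x P) Q"
      by simp
    moreover have "insert x P \<union> Q = insert x V" "insert x P \<inter> Q = {}" using PQ x by auto
    ultimately show ?thesis by blast
  qed
qed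

text \<open>The larger side of a cut is halved: the half with more crossing edges becomes
  \<open>X\<close>, the other becomes the reserve \<open>W\<close>. This costs another factor 2 in
  the edges, and the summand 2 accounts for an odd side.\<close>

lemma cut_with_reserve:
  assumes V: "finite V" and sym: "\<And>u v. g u v \<longleftrightarrow> g v u" and irr: "\<And>u. \<not> g u u"
  shows "\<exists>X Y W. X \<subseteq> V \<and> Y \<subseteq> V \<and> W \<subseteq> V \<and> X \<inter> Y = {} \<and> X \<inter> W = {} \<and> Y \<inter> W = {} \<and>
    card V \<le> 4 * card W + 2 \<and> edge_count g V V \<le> 8 * edge_count g X Y"
proof -
  obtain P Q where PQ: "P \<union> Q = V" "P \<inter> Q = {}" "edge_count g V V \<le> 4 * edge_count g P Q"
    "card Q \<le> card P"
  proof -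
    obtain P Q where PQ: "P \<union> Q = V" "P \<inter> Q = {}" "edge_count g V V \<le> 4 * edge_count g P Q"
      using max_cut[of V g] assms by blast
    show ?thesis
    proof (cases "card Q \<le> card P")
      case True
      then show ?thesis using that PQ by blast
    next
      case False
      then show ?thesis using that[of Q P] PQ edge_count_commute[of g P Q, OF sym] by auto
    qed
  qed
  have fin: "finite P" "finite Q" using PQ V by auto
  have "card P div 2 \<le> card P" by simp
  then obtain A where A: "A \<subseteq> P" "card A = card P div 2"
    by (rule obtain_subset_with_card_n)
  have fA: "finite A" using A fin finite_subset by blast
  have cP: "card V \<le> 2 * card P"
    using PQ fin card_Un_disjoint[of P Q] by simp
  have "P = A \<union> (P - A)" using A by auto
  then have e: "edge_count g P Q = edge_count g A Q + edge_count g (P - A) Q"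
    using edge_count_Un_left[of A "P - A" g Q] fA fin by auto
  have cA: "card (P - A) = card P - card P div 2" using A fA by (simp add: card_Diff_subset)
  show ?thesis
  proof (cases "edge_count g A Q \<le> edge_count g (P - A) Q")
    case True
    show ?thesis
      by (rule exI[of _ "P - A"], rule exI[of _ Q], rule exI[of _ A])
        (use True e cP A PQ in auto)
  next
    case False
    show ?thesis
      by (rule exI[of _ A], rule exI[of _ Q], rule exI[of _ "P - A"])
        (use False e cP cA A PQ in auto)
  qed
qed

section \<open>Cycles through the random graph\<close>

lemma finite_all_pairs: "finite (all_pairs n)"
proof (rule finite_subset)
  show "all_pairs n \<subseteq> Pow {..<n}" by (auto simp: all_pairs_def)
qed simp

lemma doubleton_in_all_pairs: "{a, b} \<in> all_pairs n \<longleftrightarrow> a < n \<and> b < n \<and> a \<noteq> b"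
proof
  assume "a < n \<and> b < n \<and> a \<noteq> b"
  then have "min a b < max a b" "max a b < n" "{a, b} = {min a b, max a b}"
    by (auto simp: min_def max_def)
  then show "{a, b} \<in> all_pairs n" unfolding all_pairs_def by blast
qed (auto simp: all_pairs_def doubleton_eq_iff)

text \<open>Union bound over at most \<open>n ^ (2 * s)\<close> pairs of disjoint
  \<open>s\<close>-sets, each of which is unjoined only if \<open>s * s\<close> distinct vertex
  pairs are all absent.\<close>

lemma prob_not_joined:
  assumes p: "0 \<le> p" "p \<le> 1" and s: "s \<le> n"
  shows "measure_pmf.prob (gnp n p) {R. \<not> joined s {..<n} R} \<le> real n ^ (2 * s) * (1 - p) ^ (s * s)"
proof -
  let ?M = "random_subset p (all_pairs n)"
  define K where "K = {A. A \<subseteq> {..<n} \<and> card A = s}"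
  define I where "I = {(A, B) \<in> K \<times> K. A \<inter> B = {}}"
  define D where "D = (\<lambda>(A, B). (\<lambda>(a, b). {a, b}) ` (A \<times> B :: (nat \<times> nat) set))"
  have finK: "finite K" unfolding K_def by (rule finite_subset[of _ "Pow {..<n}"]) auto
  have finI: "finite I" unfolding I_def
    by (rule finite_subset[of _ "K \<times> K"]) (use finK in auto)
  have "card I \<le> card K * card K"
    using card_mono[of "K \<times> K" I] finK by (auto simp: I_def card_cartesian_product)
  also have "card K = n choose s" unfolding K_def using n_subsets[of "{..<n}" s] by simp
  also have "(n choose s) * (n choose s) \<le> n ^ s * n ^ s"
    using binomial_le_pow[OF s] by (intro mult_mono) auto
  finally have cI: "card I \<le> n ^ (2 * s)" by (simp add: power_add[symmetric] mult_2)
  have pr: "measure_pmf.prob ?M {R. R \<inter> D i = {}} = (1 - p) ^ (s * s)" if iI: "i \<in> I" for i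
  proof -
    obtain A B where i: "i = (A, B)" "A \<subseteq> {..<n}" "B \<subseteq> {..<n}" "card A = s" "card B = s" "A \<inter> B = {}"
      using iI by (auto simp: I_def K_def)
    have "inj_on (\<lambda>(a, b). {a, b}) (A \<times> B)"
      using i by (auto simp: inj_on_def doubleton_eq_iff)
    then have "card (D i) = s * s" using i by (simp add: D_def card_image card_cartesian_product)
    moreover have "D i \<subseteq> all_pairs n"
      using i by (auto simp: D_def doubleton_in_all_pairs)
    ultimately show ?thesis using prob_random_subset_disjnt[OF finite_all_pairs _ p] by metis
  qed
  have "measure_pmf.prob ?M {R. \<not> joined s {..<n} R} \<le> measure_pmf.prob ?M (\<Union>i\<in>I. {R. R \<inter> D i = {}})"
  proof (rule measure_pmf.finite_measure_mono)
    show "{R. \<not> joined s {..<n} R} \<subseteq> (\<Union>i\<in>I. {R. R \<inter> D i = {}})"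
    proof
      fix R assume "R \<in> {R. \<not> joined s {..<n} R}"
      then obtain A B where AB: "(A, B) \<in> I" "\<And>a b. a \<in> A \<Longrightarrow> b \<in> B \<Longrightarrow> {a, b} \<notin> R"
        unfolding joined_def I_def K_def by blast
      then have "R \<inter> D (A, B) = {}" by (auto simp: D_def)
      with AB show "R \<in> (\<Union>i\<in>I. {R. R \<inter> D i = {}})" by blast
    qed
  qed simp
  also have "\<dots> \<le> (\<Sum>i\<in>I. measure_pmf.prob ?M {R. R \<inter> D i = {}})"
    by (rule measure_UNION_le) (use finI in auto)
  also have "\<dots> = real (card I) * (1 - p) ^ (s * s)" using pr by simp
  also have "\<dots> \<le> real n ^ (2 * s) * (1 - p) ^ (s * s)"
    using p cI by (intro mult_right_mono) (auto simp flip: of_nat_power)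
  finally show ?thesis unfolding gnp_eq_random_subset .
qed

lemma cycle_copy_mono: "cycle_copy n E l f \<Longrightarrow> E \<subseteq> E' \<Longrightarrow> cycle_copy n E' l f"
  unfolding cycle_copy_def by blast

text \<open>Once the edges inside \<open>W\<close> are exposed, the paths they contain act like single vertices:
  an edge \<open>uv\<close> of \<open>G\<close> between \<open>X\<close> and \<open>Y\<close> closes a cycle through a path if \<open>u\<close> and \<open>v\<close> are
  joined to its two ends, and different paths use disjoint sets of edges for this.\<close>

lemma prob_no_cycle:
  assumes l: "3 \<le> l" and p: "0 \<le> p" "p \<le> 1" and s: "1 \<le> s"
    and sub: "X \<subseteq> {..<n}" "Y \<subseteq> {..<n}" "W \<subseteq> {..<n}"
    and disj: "X \<inter> Y = {}" "X \<inter> W = {}" "Y \<inter> W = {}"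
    and W: "2 * s * (l - 2) + k * (l - 2) \<le> card W"
    and a: "a \<le> card {u\<in>X. d \<le> card {v\<in>Y. {u, v} \<in> G}}"
  shows "measure_pmf.prob (gnp n p) {R. joined s {..<n} R \<and>
      \<not> (\<exists>f. cycle_copy n (G \<union> R) l f \<and> f ` {..<l} \<subseteq> X \<union> Y \<union> W)}
    \<le> (1 - (1 - (1 - p) ^ a) * (1 - (1 - p) ^ d)) ^ k"
proof -
  let ?q = "1 - (1 - (1 - p) ^ a) * (1 - (1 - p) ^ d)"
  define A where "A = {e\<in>all_pairs n. e \<subseteq> W}"
  define B where "B = all_pairs n - A"
  define Q where "Q S T \<longleftrightarrow> \<not> (\<exists>f. cycle_copy n (G \<union> (S \<union> T)) l f \<and> f ` {..<l} \<subseteq> X \<union> Y \<union> W)" for S T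
  have fin: "finite X" "finite Y" "finite W" "finite A" "finite B" "A \<inter> B = {}"
    using sub finite_all_pairs finite_subset[OF _ finite_lessThan] by (auto simp: A_def B_def)
  have AB: "A \<union> B = all_pairs n" by (auto simp: A_def B_def)
  have q: "0 \<le> ?q"
    using p mult_le_one[of "1 - (1 - p) ^ a" "1 - (1 - p) ^ d"] by (simp add: power_le_one)
  have stage: "measure_pmf.prob (random_subset p B) {T. Q S T} \<le> ?q ^ k" if J: "joined s W S" for S
  proof -
    obtain ps where ps: "\<And>j. j < k \<Longrightarrow> path_in S (ps j)" "\<And>j. j < k \<Longrightarrow> length (ps j) = l - 2"
      "\<And>j. j < k \<Longrightarrow> set (ps j) \<subseteq> W"
      "\<And>i j. i < k \<Longrightarrow> j < k \<Longrightarrow> i \<noteq> j \<Longrightarrow> set (ps i) \<inter> set (ps j) = {}"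
    proof -
      have "1 \<le> l - 2" using l by simp
      from joined_disjoint_paths[OF J s this fin(3) order_refl W]
      obtain ps where "\<forall>j<k. path_in S (ps j) \<and> length (ps j) = l - 2 \<and> set (ps j) \<subseteq> W"
        "\<forall>i<k. \<forall>j<k. i \<noteq> j \<longrightarrow> set (ps i) \<inter> set (ps j) = {}" by (elim exE conjE)
      then show ?thesis by (intro that[of ps]) simp_all
    qed
    \<comment> \<open>For \<open>l = 3\<close> the paths are single vertices and \<open>hd\<close>
      equals \<open>last\<close>; \<open>f j u\<close> and \<open>h j v\<close> still differ because
      \<open>X\<close> and \<open>Y\<close> are disjoint.\<close>
    define f h where "f j u = {u, hd (ps j)}" and "h j v = {v, last (ps j)}" for j u v
    have ends: "hd (ps j) \<in> set (ps j)" "last (ps j) \<in> set (ps j)" "ps j \<noteq> []" if "j < k" for j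
    proof -
      show "ps j \<noteq> []" using ps(2)[OF that] l by auto
      then show "hd (ps j) \<in> set (ps j)" "last (ps j) \<in> set (ps j)" by simp_all
    qed
    have endsW: "hd (ps j) \<in> W" "last (ps j) \<in> W" if "j < k" for j
      using ends[OF that] ps(3)[OF that] by auto
    have "measure_pmf.prob (random_subset p B) {T. Q S T} \<le> measure_pmf.prob (random_subset p B)
      {T. \<forall>j<k. \<not> (\<exists>u\<in>X. \<exists>v\<in>Y. {u, v} \<in> G \<and> f j u \<in> T \<and> h j v \<in> T)}"
    proof (rule measure_pmf.finite_measure_mono; clarsimp)
      fix T j u v
      assume QT: "Q S T" and j: "j < k" and uv: "u \<in> X" "v \<in> Y" "{u, v} \<in> G" "f j u \<in> T" "h j v \<in> T"
      let ?E = "G \<union> (S \<union> T)"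
      have sw: "successively (\<lambda>a b. {a, b} \<in> ?E) (ps j)"
        by (rule successively_mono[of "\<lambda>a b. {a, b} \<in> S"]) (use ps(1)[OF j] in \<open>auto simp: path_in_def\<close>)
      \<comment> \<open>The cycle runs through \<open>v\<close>, \<open>u\<close> and then the path:
        \<open>G\<close> supplies \<open>uv\<close>, the first stage \<open>S\<close> the path, and
        \<open>T\<close> its two links to \<open>u\<close> and \<open>v\<close>.\<close>
      have path: "path_in ?E (v # u # ps j)"
        using sw ps(1)[OF j] ps(3)[OF j] uv disj
        by (auto simp: path_in_def successively_Cons f_def insert_commute)
      have last: "{last (u # ps j), v} \<in> ?E"
        using ends[OF j] uv by (simp add: h_def insert_commute)
      have XYW: "set (v # u # ps j) \<subseteq> X \<union> Y \<union> W" using uv ps(3)[OF j] by auto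
      then have "set (v # u # ps j) \<subseteq> {..<n}" using sub by blast
      moreover have "length (u # ps j) = l - 1" "2 \<le> l" using ps(2)[OF j] l by simp_all
      ultimately obtain c where "cycle_copy n ?E l c" "c ` {..<l} = set (v # u # ps j)"
        using cycle_copy_of_path[OF path _ _ last] by blast
      then show False using QT XYW unfolding Q_def by blast
    qed
    also have "\<dots> \<le> ?q ^ k"
    proof (rule prob_no_open_edge_family)
      show "inj_on (f j) X" "inj_on (h j) Y" for j
        by (auto simp: inj_on_def f_def h_def doubleton_eq_iff)
      show "f j ` X \<inter> h j ` Y = {}" if "j < k" for j
        using endsW[OF that] disj by (auto simp: f_def h_def doubleton_eq_iff)
      show "(f i ` X \<union> h i ` Y) \<inter> (f j ` X \<union> h j ` Y) = {}" if ij: "i < k" "j < k" "i \<noteq> j" for i j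
      proof -
        have "hd (ps i) \<noteq> hd (ps j)" "last (ps i) \<noteq> last (ps j)"
          using ps(4)[OF ij] ends(1,2)[OF ij(1)] ends(1,2)[OF ij(2)] by (metis disjoint_iff)+
        then show ?thesis using endsW[OF ij(1)] endsW[OF ij(2)] disj
          by (auto simp: f_def h_def doubleton_eq_iff)
      qed
      show "(\<Union>j<k. f j ` X \<union> h j ` Y) \<subseteq> B"
      proof -
        have "{u, w} \<in> B" if "u \<in> X \<union> Y" "w \<in> W" for u w
          using that sub disj unfolding A_def B_def by (auto simp: doubleton_in_all_pairs)
        then show ?thesis using endsW by (fastforce simp: f_def h_def)
      qed
    qed (use fin p a in auto)
    finally show ?thesis .
  qed
  have "measure_pmf.prob (gnp n p) {R. joined s {..<n} R \<and>
      \<not> (\<exists>f. cycle_copy n (G \<union> R) l f \<and> f ` {..<l} \<subseteq> X \<union> Y \<union> W)}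
    \<le> measure_pmf.prob (gnp n p) {R. joined s W (R \<inter> A) \<and> Q (R \<inter> A) (R \<inter> B)}"
  proof (rule measure_pmf.finite_measure_mono)
    \<comment> \<open>An edge joining two subsets of \<open>W\<close> lies inside \<open>W\<close>,
      so it survives the restriction to \<open>A\<close>.\<close>
    have "joined s W (R \<inter> A)" if J: "joined s {..<n} R" for R
      unfolding joined_def
    proof (intro allI impI)
      fix A' B' assume AB': "A' \<subseteq> W" "B' \<subseteq> W" "card A' = s" "card B' = s" "A' \<inter> B' = {}"
      then have "A' \<subseteq> {..<n}" "B' \<subseteq> {..<n}" using sub by auto
      then obtain a b where ab: "a \<in> A'" "b \<in> B'" "{a, b} \<in> R"
        using J[unfolded joined_def, rule_format, of A' B'] AB' by blast
      moreover have "{a, b} \<in> A"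
        using ab AB' sub by (auto simp: A_def doubleton_in_all_pairs)
      ultimately show "\<exists>a\<in>A'. \<exists>b\<in>B'. {a, b} \<in> R \<inter> A" by blast
    qed
    moreover have "Q (R \<inter> A) (R \<inter> B)"
      if "\<not> (\<exists>f. cycle_copy n (G \<union> R) l f \<and> f ` {..<l} \<subseteq> X \<union> Y \<union> W)" for R
    proof -
      have "G \<union> (R \<inter> A \<union> R \<inter> B) \<subseteq> G \<union> R" by auto
      then show ?thesis using that cycle_copy_mono unfolding Q_def by blast
    qed
    ultimately show "{R. joined s {..<n} R \<and>
        \<not> (\<exists>f. cycle_copy n (G \<union> R) l f \<and> f ` {..<l} \<subseteq> X \<union> Y \<union> W)}
      \<subseteq> {R. joined s W (R \<inter> A) \<and> Q (R \<inter> A) (R \<inter> B)}" by blast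
  qed simp
  also have "\<dots> = measure_pmf.prob (random_subset p (A \<union> B)) {R. joined s W (R \<inter> A) \<and> Q (R \<inter> A) (R \<inter> B)}"
    unfolding AB gnp_eq_random_subset ..
  also have "\<dots> \<le> measure_pmf.prob (random_subset p A) {S. joined s W S} * ?q ^ k"
    by (rule prob_random_subset_two_stage) (use fin q stage in auto)
  also have "\<dots> \<le> 1 * ?q ^ k" using q by (intro mult_right_mono) auto
  finally show ?thesis by simp
qed

section \<open>Deleting vertices and assembling the cycles\<close>

lemma edge_count_le_degree:
  assumes "finite P" "\<And>u. u \<in> P \<Longrightarrow> card {v\<in>Q. g u v} \<le> \<Delta>" "finite Q"
  shows "edge_count g P Q \<le> card P * \<Delta>"
  using sum_bounded_above[of P "\<lambda>u. card {v\<in>Q. g u v}" \<Delta>] assms by (simp add: edge_count_eq_sum_card)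

text \<open>A deleted vertex lies in at most one of \<open>X\<close> and \<open>Y\<close> and takes
  at most \<open>\<Delta>\<close> crossing edges with it.\<close>

lemma edge_count_Diff:
  assumes fin: "finite X" "finite Y" "finite U" and XY: "X \<inter> Y = {}"
    and sym: "\<And>u v. g u v \<longleftrightarrow> g v u"
    and \<Delta>: "\<And>u. u \<in> X \<Longrightarrow> card {v\<in>Y. g u v} \<le> \<Delta>" "\<And>v. v \<in> Y \<Longrightarrow> card {u\<in>X. g v u} \<le> \<Delta>"
  shows "edge_count g X Y \<le> edge_count g (X - U) (Y - U) + card U * \<Delta>"
proof -
  have "X = (X - U) \<union> (X \<inter> U)" "Y = (Y - U) \<union> (Y \<inter> U)" by auto
  then have "edge_count g X Y = edge_count g (X - U) Y + edge_count g (X \<inter> U) Y"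
    "edge_count g (X - U) Y = edge_count g (X - U) (Y - U) + edge_count g (X - U) (Y \<inter> U)"
    using edge_count_Un_left[of "X - U" "X \<inter> U" g Y] edge_count_Un_right[of "Y - U" "Y \<inter> U" g "X - U"]
      fin by (metis Diff_disjoint Int_Diff Int_Diff_disjoint Int_commute finite_Diff finite_Int)+
  moreover have "edge_count g (X \<inter> U) Y \<le> card (X \<inter> U) * \<Delta>"
    using fin \<Delta> by (intro edge_count_le_degree) auto
  moreover have "edge_count g (Y \<inter> U) (X - U) \<le> card (Y \<inter> U) * \<Delta>"
  proof (intro edge_count_le_degree)
    fix v assume v: "v \<in> Y \<inter> U"
    have "card {u \<in> X - U. g v u} \<le> card {u\<in>X. g v u}" by (rule card_mono) (use fin in auto)
    then show "card {u \<in> X - U. g v u} \<le> \<Delta>" using \<Delta>(2)[of v] v by auto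
  qed (use fin in auto)
  moreover have "edge_count g (Y \<inter> U) (X - U) = edge_count g (X - U) (Y \<inter> U)"
    using edge_count_commute sym by metis
  moreover have "card (X \<inter> U) * \<Delta> + card (Y \<inter> U) * \<Delta> \<le> card U * \<Delta>"
  proof -
    have "card (X \<inter> U) + card (Y \<inter> U) = card (X \<inter> U \<union> Y \<inter> U)"
      using fin XY by (subst card_Un_disjoint) auto
    also have "\<dots> \<le> card U" using fin by (intro card_mono) auto
    finally show ?thesis by (simp add: add_mult_distrib[symmetric])
  qed
  ultimately show ?thesis by linarith
qed

lemma disjoint_cycles_with_hubs:
  fixes l m n s :: nat and G R :: "nat set set" and H :: "nat set"
  defines "b \<equiv> m - card H"
  assumes l: "3 \<le> l" and m: "64 * l^2 * m \<le> n" and G: "is_graph n G"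
    and J: "joined s {..<n} R" and s: "1 \<le> s" "192 * l^2 * s \<le> n"
    and H: "H \<subseteq> {..<n}" "\<And>v. v \<in> H \<Longrightarrow> n \<le> 32 * l * degree G v" "card H \<le> m"
    and cyc: "\<And>U. 0 < b \<Longrightarrow> U \<subseteq> {..<n} \<Longrightarrow> card U = l * b \<Longrightarrow>
      \<exists>f. cycle_copy n (G \<union> R) l f \<and> f ` {..<l} \<inter> (U \<union> H) = {}"
  shows "has_disjoint_cycles n (G \<union> R) l m"
proof -
  have finH: "finite H" using H(1) finite_subset by blast
  obtain v where v: "bij_betw v {..<card H} H"
    using ex_bij_betw_nat_finite[OF finH] by (auto simp: lessThan_atLeast0)
  \<comment> \<open>Each later cycle meets \<open>H\<close> only in its own hub, so the hubs still
    to come stay free.\<close>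
  define P where "P i f \<longleftrightarrow> cycle_copy n (G \<union> R) l f \<and>
    f ` {..<l} \<inter> H = (if i < b then {} else {v (i - b)})" for i f
  have img: "f ` {..<l} \<subseteq> {..<n}" "card (f ` {..<l}) = l" if "P i f" for i f
    using that by (auto simp: P_def cycle_copy_def card_image)
  have lm: "3 * (l * m) \<le> l^2 * m" using l by (simp add: power2_eq_square)
  have "\<exists>F. (\<forall>i<m. P i (F i)) \<and>
      (\<forall>i<m. \<forall>j<m. i \<noteq> j \<longrightarrow> F i ` {..<l} \<inter> F j ` {..<l} = {})"
  proof (rule greedy_disjoint)
    fix i F assume i: "i < m" and F: "\<forall>j<i. P j (F j)"
    define U where "U = (\<Union>j<i. F j ` {..<l})"
    have finU: "finite U" by (simp add: U_def)
    have Un: "U \<subseteq> {..<n}" using F img(1) unfolding U_def by blast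
    have cU: "card U \<le> l * i"
    proof -
      have "card U \<le> (\<Sum>j<i. card (F j ` {..<l}))" unfolding U_def by (rule card_UN_le) simp
      also have "\<dots> = (\<Sum>j<i. l)" using F img(2) by (intro sum.cong) auto
      finally show ?thesis by (simp add: mult.commute)
    qed
    have "\<exists>f. P i f \<and> f ` {..<l} \<inter> U = {}"
    proof (cases "i < b")
      case True
      have "card U \<le> l * b" using cU True by (meson less_imp_le mult_le_mono2 order_trans)
      moreover have "l * b \<le> n"
      proof -
        have "l * b \<le> l * m" by (simp add: b_def)
        then show ?thesis using lm m by linarith
      qed
      \<comment> \<open>The used vertices are padded to exactly \<open>l * b\<close>, the size that
        \<open>cyc\<close> asks for.\<close>
      ultimately obtain U' where U': "U \<subseteq> U'" "U' \<subseteq> {..<n}" "card U' = l * b"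
        using exists_subset_between[of U "l * b" "{..<n}"] Un by auto
      obtain f where "cycle_copy n (G \<union> R) l f" "f ` {..<l} \<inter> (U' \<union> H) = {}"
        using cyc[of U'] True U' by auto
      then have "P i f \<and> f ` {..<l} \<inter> U = {}" using True U' unfolding P_def by auto
      then show ?thesis by (rule exI[of _ f])
    next
      case False
      define w where "w = v (i - b)"
      have ib: "i - b < card H" using i False H(3) by (auto simp: b_def)
      have w: "w \<in> H" using v ib by (auto simp: w_def bij_betw_def)
      have wU: "w \<notin> U"
      proof
        assume "w \<in> U"
        then obtain j where j: "j < i" "w \<in> F j ` {..<l}" by (auto simp: U_def)
        then have "w \<in> F j ` {..<l} \<inter> H" using w by simp
        then have "\<not> j < b" "w = v (j - b)" using F j(1) by (auto simp: P_def split: if_splits)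
        moreover have "j - b < card H" "j - b \<noteq> i - b" using j(1) ib \<open>\<not> j < b\<close> by auto
        ultimately show False using v ib unfolding w_def bij_betw_def inj_on_def by auto
      qed
      define N where "N = {u. {u, w} \<in> G}"
      have NG: "u < n \<and> u \<noteq> w" if "u \<in> N" for u
        using that G doubleton_in_all_pairs unfolding N_def is_graph_def by blast
      then have finN: "finite N" by (meson finite_lessThan finite_subset lessThan_iff subsetI)
      have cN: "n \<le> 32 * l * card N" using H(2)[OF w] by (simp add: N_def degree_def)
      define A where "A = N - (U \<union> H)"
      have A: "A \<subseteq> {..<n}" "finite A" using NG finN by (auto simp: A_def)
      have "card (U \<union> H) \<le> l * m + m"
      proof -
        have "card (U \<union> H) \<le> card U + card H" by (rule card_Un_le)
        moreover have "l * i \<le> l * m" using i by simp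
        ultimately show ?thesis using cU H(3) by linarith
      qed
      then have cA: "card N \<le> card A + (l * m + m)"
        using diff_card_le_card_Diff[of "U \<union> H" N] finU finH by (auto simp: A_def)
      \<comment> \<open>From \<open>n \<le> 32 * l * card N\<close>, used vertices and hubs take at
        most \<open>n / 2 + n / 6\<close>, because \<open>64 * l^2 * m \<le> n\<close> and
        \<open>l \<ge> 3\<close>; the remaining \<open>n / 3\<close> is at least
        \<open>64 * l^2 * s\<close>.\<close>
      have "2 * s * (l - 1) \<le> card A"
      proof -
        have "n \<le> 32 * l * (card A + (l * m + m))"
          using cN cA by (meson mult_le_mono2 order_trans)
        also have "\<dots> = 32 * (l * card A) + 32 * (l^2 * m) + 32 * (l * m)"
          by (simp add: algebra_simps power2_eq_square)
        finally have "64 * (l^2 * s) \<le> 32 * (l * card A)"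
          using lm m s(2) by linarith
        then have "l * (2 * s * l) \<le> l * card A" by (simp add: power2_eq_square mult_ac)
        then have "2 * s * l \<le> card A" using l by simp
        moreover have "2 * s * (l - 1) \<le> 2 * s * l" by simp
        ultimately show ?thesis by linarith
      qed
      moreover have "1 \<le> l - 1" using l by simp
      ultimately obtain xs where xs: "path_in R xs" "length xs = l - 1" "set xs \<subseteq> A"
        using joined_path[OF J s(1) _ A(2,1)] by blast
      have ne: "xs \<noteq> []" using xs l by auto
      then have "hd xs \<in> A" "last xs \<in> A" using xs(3) by auto
      then have ends: "{hd xs, w} \<in> G" "{last xs, w} \<in> G" by (auto simp: A_def N_def)
      have wxs: "w \<notin> set xs" using xs(3) w by (auto simp: A_def)
      have "successively (\<lambda>a b. {a, b} \<in> G \<union> R) xs"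
        by (rule successively_mono[of "\<lambda>a b. {a, b} \<in> R"]) (use xs(1) in \<open>auto simp: path_in_def\<close>)
      then have path: "path_in (G \<union> R) (w # xs)"
        using xs(1) wxs ends by (auto simp: path_in_def successively_Cons insert_commute)
      have "{last xs, w} \<in> G \<union> R" using ends by simp
      moreover have "set (w # xs) \<subseteq> {..<n}" using xs(3) A w H(1) by auto
      moreover have "2 \<le> l" using l by simp
      ultimately obtain f where f: "cycle_copy n (G \<union> R) l f" "f ` {..<l} = set (w # xs)"
        using cycle_copy_of_path[OF path xs(2)] by blast
      have "f ` {..<l} \<inter> H = {w}" "f ` {..<l} \<inter> U = {}"
        using f(2) w wU xs(3) by (auto simp: A_def)
      then show ?thesis using f(1) False unfolding P_def w_def by auto
    qed
    then show "\<exists>f. P i f \<and> (\<forall>j<i. F j ` {..<l} \<inter> f ` {..<l} = {})"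
      unfolding U_def by blast
  qed
  then show ?thesis unfolding has_disjoint_cycles_def P_def by blast
qed

text \<open>Off \<open>H\<close> the cut has at least \<open>card V * b / 8\<close> edges, and
  deleting \<open>U\<close> destroys at most \<open>n * b / 32\<close> of them, as all degrees are
  below \<open>n / (32 * l)\<close>. The \<open>n * b / 16\<close> edges that remain feed
  \<open>exists_degree_level\<close>, whose bound is raised to the number \<open>k\<close> of
  paths.\<close>

lemma prob_no_cycle_avoiding:
  fixes l m n s b :: nat and p :: real and G :: "nat set set" and H U :: "nat set"
  assumes l: "3 \<le> l" and m: "64 * l^2 * m \<le> n" and G: "is_graph n G" "min_degree_ge n G m"
    and s: "1 \<le> s" "192 * l^2 * s \<le> n"
    and p: "0 < p" "p \<le> 1" "5120 * real l ^ 2 * ln (real n) \<le> p * real n"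
    and H: "H \<subseteq> {..<n}" "\<And>v. v < n \<Longrightarrow> v \<notin> H \<Longrightarrow> 32 * l * degree G v < n"
    and b: "card H + b = m" "0 < b"
    and U: "U \<subseteq> {..<n}" "card U = l * b"
  shows "measure_pmf.prob (gnp n p) {R. joined s {..<n} R \<and>
      \<not> (\<exists>f. cycle_copy n (G \<union> R) l f \<and> f ` {..<l} \<inter> (U \<union> H) = {})}
    \<le> exp (- (2 * real (l * b) * ln (real n)))"
proof -
  let ?g = "\<lambda>u v. {u, v} \<in> G"
  define V where "V = {..<n} - H"
  define \<Delta> where "\<Delta> = n div (32 * l)"
  have fin: "finite V" "finite H" "finite U" using H(1) U(1) finite_subset by (auto simp: V_def)
  have sym: "?g u v \<longleftrightarrow> ?g v u" for u v by (simp add: insert_commute)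
  have irr: "\<not> ?g u u" for u
    using G(1) doubleton_in_all_pairs[of u u n] unfolding is_graph_def by auto
  have l2: "9 \<le> l^2" using l power_mono[of 3 l 2] by simp
  have "9 * s \<le> l^2 * s" using l2 by simp
  then have n: "1728 \<le> n" using s by linarith
  have "9 * m \<le> l^2 * m" using l2 by simp
  then have mn: "576 * m \<le> n" using m by linarith
  have lm: "3 * (l * m) \<le> l^2 * m" using l by (simp add: power2_eq_square)
  have ls: "3 * (s * l) \<le> l^2 * s" using l by (simp add: power2_eq_square)
  have lbm: "l * b \<le> l * m" using b by simp
  have nbr: "{v. ?g v u} \<subseteq> {..<n}" for u
    using G(1) doubleton_in_all_pairs unfolding is_graph_def by blast
  have deg_card: "degree G u = card {v. ?g u v}" for u
    unfolding degree_def by (simp add: insert_commute)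
  have finN: "finite {v. ?g u v}" for u
    using nbr[of u] finite_subset by (auto simp: insert_commute)
  obtain X Y W where XYW: "X \<subseteq> V" "Y \<subseteq> V" "W \<subseteq> V" "X \<inter> Y = {}" "X \<inter> W = {}" "Y \<inter> W = {}"
    "card V \<le> 4 * card W + 2" "edge_count ?g V V \<le> 8 * edge_count ?g X Y"
    using cut_with_reserve[of V ?g] fin sym irr by blast
  have finXYW: "finite X" "finite Y" "finite W" using XYW fin finite_subset by blast+
  have cV: "card V + card H = n"
    using H(1) fin card_mono[of "{..<n}" H] by (simp add: V_def card_Diff_subset)
  have eV: "card V * b \<le> edge_count ?g V V"
  proof -
    have "b \<le> card {v\<in>V. ?g u v}" if u: "u \<in> V" for u
    proof -
      have "m \<le> card {v. ?g u v}"
        using G(2) u unfolding min_degree_ge_def deg_card[symmetric] by (auto simp: V_def)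
      also have "{v. ?g u v} \<subseteq> {v\<in>V. ?g u v} \<union> H"
        using nbr[of u] by (auto simp: V_def insert_commute)
      then have "card {v. ?g u v} \<le> card ({v\<in>V. ?g u v} \<union> H)"
        using fin by (intro card_mono) auto
      also have "\<dots> \<le> card {v\<in>V. ?g u v} + card H" by (rule card_Un_le)
      finally show ?thesis using b by linarith
    qed
    then have "card V * b \<le> (\<Sum>u\<in>V. card {v\<in>V. ?g u v})"
      using sum_bounded_below[of V b "\<lambda>u. card {v\<in>V. ?g u v}"] by simp
    then show ?thesis using fin by (simp only: edge_count_eq_sum_card)
  qed
  have \<Delta>: "card {v\<in>Z. ?g u v} \<le> \<Delta>" if "u \<in> V" for u Z
  proof -
    have "card {v\<in>Z. ?g u v} \<le> degree G u"
      unfolding deg_card using finN by (intro card_mono) auto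
    moreover have "32 * l * degree G u < n" using H(2)[of u] that by (auto simp: V_def)
    then have "degree G u \<le> \<Delta>"
      using l unfolding \<Delta>_def by (simp add: less_eq_div_iff_mult_less_eq mult.commute)
    ultimately show ?thesis by linarith
  qed
  have eXY: "edge_count ?g X Y \<le> edge_count ?g (X - U) (Y - U) + card U * \<Delta>"
    by (rule edge_count_Diff) (use finXYW fin XYW sym \<Delta> in auto)
  have loss: "32 * (card U * \<Delta>) \<le> b * n"
  proof -
    have "32 * (card U * \<Delta>) = b * (32 * l * \<Delta>)" by (simp add: U)
    also have "\<dots> \<le> b * n" unfolding \<Delta>_def by (intro mult_le_mono2) simp
    finally show ?thesis .
  qed
  define e where "e = edge_count ?g (X - U) (Y - U)"
  have e: "n * b \<le> 16 * e"
  proof -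
    \<comment> \<open>\<open>H\<close> has at most \<open>m \<le> n / 576\<close> vertices; the
      count then works because \<open>575 / 4608 - 1 / 32 > 1 / 16\<close>.\<close>
    have "576 * card V \<ge> 575 * n" using cV b mn by linarith
    then have "575 * n * b \<le> 576 * card V * b" by (rule mult_le_mono1)
    moreover have "card V * b \<le> 8 * (e + card U * \<Delta>)"
      using order_trans[OF order_trans[OF eV XYW(8)] mult_le_mono2[OF eXY]] unfolding e_def .
    ultimately have "575 * (n * b) \<le> 4608 * e + 4608 * (card U * \<Delta>)"
      unfolding mult.assoc distrib_left by linarith
    then show ?thesis using loss by (simp add: mult.commute)
  qed
  have e_sum: "e = (\<Sum>u\<in>X - U. card {v\<in>Y - U. ?g u v})"
    using finXYW by (simp only: e_def edge_count_eq_sum_card finite_Diff)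
  have Vn: "V \<subseteq> {..<n}" by (auto simp: V_def)
  have XYn: "card (X - U) \<le> n" "card {v\<in>Y - U. ?g u v} \<le> n" for u
  proof -
    have "X - U \<subseteq> {..<n}" "{v\<in>Y - U. ?g u v} \<subseteq> {..<n}" using XYW Vn by auto
    then show "card (X - U) \<le> n" "card {v\<in>Y - U. ?g u v} \<le> n"
      using card_mono[OF finite_lessThan] by (metis card_lessThan)+
  qed
  have ln_ge: "1 \<le> ln (real n)"
    using n exp_le by (subst ln_ge_iff) auto
  have "1 * ln (real n) \<le> 5120 * real l ^ 2 * ln (real n)"
    using ln_ge l2 by (intro mult_right_mono) (auto simp flip: of_nat_power)
  then have "ln (real n) \<le> p * real n" using p(3) by linarith
  moreover have "real n * real b / 16 \<le> real (\<Sum>u\<in>X - U. card {v\<in>Y - U. ?g u v})"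
    using e unfolding e_sum[symmetric] by (simp flip: of_nat_mult)
  ultimately obtain a d where ad: "a \<le> card {u\<in>X - U. d \<le> card {v\<in>Y - U. ?g u v}}"
    "1 - (1 - (1 - p) ^ a) * (1 - (1 - p) ^ d) \<le> exp (- (p * real b / 256))"
    using exists_degree_level[of "X - U" n "\<lambda>u. card {v\<in>Y - U. ?g u v}" b p]
      finXYW XYn b(2) ln_ge p by auto
  let ?q = "1 - (1 - (1 - p) ^ a) * (1 - (1 - p) ^ d)"
  \<comment> \<open>The summand 1 rounds up and gives \<open>n \<le> 10 * l * k\<close>. The paths
    then need at most about \<open>n / 10\<close> vertices, while the reserve has at least about
    \<open>n / 4\<close>.\<close>
  define k where "k = n div (10 * l) + 1"
  have k: "n \<le> 10 * (l * k)" "10 * (l * k) \<le> n + 10 * l"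
  proof -
    have *: "n = 10 * l * (n div (10 * l)) + n mod (10 * l)" by simp
    moreover have "n mod (10 * l) < 10 * l" using l by simp
    ultimately have "n \<le> 10 * l * (n div (10 * l)) + 10 * l" by linarith
    then show "n \<le> 10 * (l * k)" by (simp add: k_def algebra_simps)
    have "10 * l * (n div (10 * l)) \<le> n" using * by linarith
    then show "10 * (l * k) \<le> n + 10 * l" by (simp add: k_def algebra_simps)
  qed
  have W: "2 * s * (l - 2) + k * (l - 2) \<le> card (W - U)"
  proof -
    have "2 * s * (l - 2) + k * (l - 2) \<le> 2 * s * l + k * l"
      by (intro add_mono mult_le_mono2) auto
    also have "\<dots> = 2 * (s * l) + l * k" by simp
    also have "\<dots> \<le> card W - card U"
    proof -
      \<comment> \<open>The rounding error in \<open>l * k\<close> is at most \<open>l\<close>,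
        hence at most \<open>s * l \<le> n / 576\<close>.\<close>
      have "l \<le> s * l" using s(1) by simp
      then show ?thesis using U(2) lbm lm m ls s(2) k(2) XYW(7) cV b(1) mn n by linarith
    qed
    also have "\<dots> \<le> card (W - U)" using fin by (intro diff_card_le_card_Diff)
    finally show ?thesis .
  qed
  have "measure_pmf.prob (gnp n p) {R. joined s {..<n} R \<and>
      \<not> (\<exists>f. cycle_copy n (G \<union> R) l f \<and> f ` {..<l} \<inter> (U \<union> H) = {})}
    \<le> measure_pmf.prob (gnp n p) {R. joined s {..<n} R \<and>
      \<not> (\<exists>f. cycle_copy n (G \<union> R) l f \<and> f ` {..<l} \<subseteq> (X - U) \<union> (Y - U) \<union> (W - U))}"
  proof (rule measure_pmf.finite_measure_mono)
    have "(X - U) \<union> (Y - U) \<union> (W - U) \<subseteq> - (U \<union> H)" using XYW by (auto simp: V_def)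
    then have "S \<inter> (U \<union> H) = {}" if "S \<subseteq> (X - U) \<union> (Y - U) \<union> (W - U)" for S
      using that by blast
    then show "{R. joined s {..<n} R \<and>
        \<not> (\<exists>f. cycle_copy n (G \<union> R) l f \<and> f ` {..<l} \<inter> (U \<union> H) = {})}
      \<subseteq> {R. joined s {..<n} R \<and>
        \<not> (\<exists>f. cycle_copy n (G \<union> R) l f \<and> f ` {..<l} \<subseteq> (X - U) \<union> (Y - U) \<union> (W - U))}"
      by blast
  qed simp
  also have "\<dots> \<le> ?q ^ k"
    by (rule prob_no_cycle) (use l p s XYW Vn W ad in auto)
  also have "\<dots> \<le> exp (- (p * real b / 256)) ^ k"
    using ad(2) p mult_le_one[of "1 - (1 - p) ^ a" "1 - (1 - p) ^ d"]
    by (intro power_mono) (auto simp: power_le_one)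
  also have "\<dots> = exp (- (p * real k * real b / 256))"
    by (simp add: exp_of_nat_mult[symmetric] mult_ac)
  also have "\<dots> \<le> exp (- (2 * real (l * b) * ln (real n)))"
  proof -
    \<comment> \<open>With \<open>n \<le> 10 * l * k\<close> the assumption on \<open>p\<close>
      becomes \<open>p * k \<ge> 512 * l * ln n\<close>, and \<open>512 = 2 * 256\<close>.\<close>
    have "real n \<le> real (10 * (l * k))" using k(1) by (simp only: of_nat_le_iff)
    then have "p * real n \<le> p * real (10 * (l * k))" using p(1) by (intro mult_left_mono) auto
    with p(3) have "5120 * real l ^ 2 * ln (real n) \<le> p * real (10 * (l * k))"
      by (rule order_trans)
    then have "real l * (512 * real l * ln (real n)) \<le> real l * (p * real k)"
      by (simp add: power2_eq_square mult_ac)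
    then have "512 * real l * ln (real n) \<le> p * real k" using l by simp
    then have "real b * (512 * real l * ln (real n)) \<le> real b * (p * real k)"
      by (rule mult_left_mono) simp
    then show ?thesis by (simp add: mult_ac)
  qed
  finally show ?thesis .
qed

section \<open>Union bound and limit\<close>

text \<open>Two bad events have probability at most \<open>1 / n\<close> each: \<open>R\<close> is
  not \<open>joined\<close>, or it is and some \<open>U\<close> of size \<open>l * b\<close> leaves
  no cycle off \<open>U\<close> and \<open>H\<close>. Outside both, the deterministic assembly
  applies.\<close>

lemma prob_disjoint_cycles:
  fixes l m n :: nat and p :: real and G :: "nat set set"
  assumes l: "3 \<le> l" and m: "64 * l^2 * m \<le> n" and G: "is_graph n G" "min_degree_ge n G m"
    and n: "192 * l^2 \<le> n"
    and p: "p \<le> 1" "5120 * real l ^ 2 * ln (real n) \<le> p * real n"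
  shows "1 - 2 / real n \<le> measure_pmf.prob (gnp n p) {R. has_disjoint_cycles n (G \<union> R) l m}"
proof -
  let ?M = "gnp n p"
  \<comment> \<open>Rounding down loses at most a factor 2, since \<open>192 * l^2 \<le> n\<close>;
    hence the 384 below.\<close>
  define s where "s = n div (192 * l^2)"
  have l0: "0 < 192 * l^2" using l by simp
  have s: "1 \<le> s" "192 * l^2 * s \<le> n" "n \<le> 384 * (l^2 * s)"
  proof -
    show s1: "1 \<le> s" using n l0 unfolding s_def by (metis One_nat_def Suc_leI div_greater_zero_iff)
    have *: "n = 192 * l^2 * s + n mod (192 * l^2)" by (simp add: s_def)
    then show "192 * l^2 * s \<le> n" by linarith
    have "n mod (192 * l^2) < 192 * l^2" using l0 by simp
    moreover have "l^2 \<le> l^2 * s" using s1 by simp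
    ultimately show "n \<le> 384 * (l^2 * s)" using * by linarith
  qed
  have "9 \<le> l^2" using l power_mono[of 3 l 2] by simp
  then have n3: "1728 \<le> n" using n by linarith
  have ln_ge: "1 \<le> ln (real n)" using n3 exp_le by (subst ln_ge_iff) auto
  have p0: "0 < p"
  proof (rule ccontr)
    assume "\<not> 0 < p"
    then have "p * real n \<le> 0" by (simp add: mult_nonpos_nonneg)
    moreover have "0 < 5120 * real l ^ 2 * ln (real n)" using l ln_ge by simp
    ultimately show False using p by linarith
  qed
  have inv_n: "exp (- (c * ln (real n))) \<le> 1 / real n" if "1 \<le> c" for c
  proof -
    have "exp (- (c * ln (real n))) \<le> exp (- ln (real n))"
      using that ln_ge by simp
    also have "\<dots> = 1 / real n" using n3 by (simp add: exp_minus field_simps)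
    finally show ?thesis .
  qed
  have pow_n: "real n ^ c = exp (real c * ln (real n))" for c
    using n3 by (simp add: exp_of_nat_mult)
  define H0 where "H0 = {v. v < n \<and> n \<le> 32 * l * degree G v}"
  have finH0: "finite H0" by (simp add: H0_def)
  \<comment> \<open>If there are at least \<open>m\<close> hubs, \<open>H\<close> takes
    \<open>m\<close> of them and \<open>b = 0\<close>; otherwise it takes all, so that every vertex
    outside has small degree.\<close>
  obtain H where H: "H \<subseteq> H0" "card H = min (card H0) m"
    using obtain_subset_with_card_n[of "min (card H0) m" H0] by (metis min.cobounded1)
  define b where "b = m - card H"
  define K where "K = {U. U \<subseteq> {..<n} \<and> card U = l * b}"
  define bad where "bad U = {R. joined s {..<n} R \<and>
    \<not> (\<exists>f. cycle_copy n (G \<union> R) l f \<and> f ` {..<l} \<inter> (U \<union> H) = {})}" for U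
  have Hn: "H \<subseteq> {..<n}" using H by (auto simp: H0_def)
  have bm: "card H + b = m" using H by (simp add: b_def)
  \<comment> \<open>For \<open>b = 0\<close> the hubs alone supply the cycles, so no set
    \<open>U\<close> is considered.\<close>
  have bad_prob: "measure_pmf.prob ?M (\<Union>U\<in>(if 0 < b then K else {}). bad U) \<le> 1 / real n"
  proof (cases "0 < b")
    case True
    then have "card H = card H0" using H(2) by (auto simp: b_def min_def split: if_splits)
    then have HH0: "H = H0" using H finH0 card_subset_eq by metis
    have "finite K" unfolding K_def by (rule finite_subset[of _ "Pow {..<n}"]) auto
    then have "measure_pmf.prob ?M (\<Union>U\<in>K. bad U) \<le> (\<Sum>U\<in>K. measure_pmf.prob ?M (bad U))"
      by (rule measure_UNION_le) auto
    also have "\<dots> \<le> (\<Sum>U\<in>K. exp (- (2 * real (l * b) * ln (real n))))"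
      unfolding bad_def
      by (intro sum_mono prob_no_cycle_avoiding[where m = m])
        (use l m G s p p0 Hn bm True in \<open>auto simp: K_def HH0 H0_def not_le\<close>)
    also have "\<dots> = real (card K) * exp (- (2 * real (l * b) * ln (real n)))" by simp
    also have "card K = n choose (l * b)" unfolding K_def using n_subsets[of "{..<n}" "l * b"] by simp
    also have "real (n choose (l * b)) \<le> real n ^ (l * b)"
    proof -
      have "l * b \<le> l * m" using bm by simp
      also have "\<dots> \<le> l^2 * m" by (simp add: power2_eq_square)
      finally have "l * b \<le> n" using m by linarith
      then show ?thesis using binomial_le_pow by (metis of_nat_le_iff of_nat_power)
    qed
    \<comment> \<open>Half of the exponent pays for the choices of \<open>U\<close>.\<close>
    also have "real n ^ (l * b) * exp (- (2 * real (l * b) * ln (real n))) =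
        exp (- (real (l * b) * ln (real n)))"
      unfolding pow_n by (simp add: exp_add[symmetric])
    also have "\<dots> \<le> 1 / real n"
    proof (rule inv_n)
      have "1 \<le> l * b" using l True by simp
      then show "1 \<le> real (l * b)" by linarith
    qed
    finally show ?thesis using True by (simp add: mult_right_mono)
  qed simp
  have not_joined: "measure_pmf.prob ?M {R. \<not> joined s {..<n} R} \<le> 1 / real n"
  proof -
    have "s \<le> 192 * l^2 * s" using l0 by simp
    then have "s \<le> n" using s(2) by linarith
    then have "measure_pmf.prob ?M {R. \<not> joined s {..<n} R} \<le> real n ^ (2 * s) * (1 - p) ^ (s * s)"
      using p p0 by (intro prob_not_joined) auto
    also have "\<dots> \<le> exp (real (2 * s) * ln (real n)) * exp (- (p * real (s * s)))"
      unfolding pow_n[symmetric] using p by (intro mult_left_mono one_minus_power_le_exp) auto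
    also have "\<dots> = exp (real s * (2 * ln (real n) - p * real s))"
      by (simp add: exp_add[symmetric] algebra_simps)
    also have "\<dots> \<le> exp (- (real s * ln (real n)))"
    proof -
      \<comment> \<open>Since \<open>5120 / 384 > 3\<close>, this gives
        \<open>p * s \<ge> 3 * ln n\<close>; two of the three logarithms pay for
        \<open>n ^ (2 * s)\<close>.\<close>
      have "5120 * real l ^ 2 * ln (real n) \<le> p * real n" by (rule p)
      also have "\<dots> \<le> p * real (384 * (l^2 * s))"
        using s(3) p0 by (intro mult_left_mono) (simp_all only: of_nat_le_iff less_imp_le)
      finally have "real l ^ 2 * (5120 * ln (real n)) \<le> real l ^ 2 * (384 * (p * real s))"
        by (simp add: mult_ac)
      then have "5120 * ln (real n) \<le> 384 * (p * real s)" using l by simp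
      then have "2 * ln (real n) - p * real s \<le> - ln (real n)" using ln_ge by linarith
      then have "real s * (2 * ln (real n) - p * real s) \<le> real s * (- ln (real n))"
        by (rule mult_left_mono) simp
      then show ?thesis by simp
    qed
    also have "\<dots> \<le> 1 / real n" by (rule inv_n) (use s(1) in simp)
    finally show ?thesis .
  qed
  let ?good = "{R. has_disjoint_cycles n (G \<union> R) l m}"
  have "UNIV \<subseteq> ?good \<union> ({R. \<not> joined s {..<n} R} \<union> (\<Union>U\<in>(if 0 < b then K else {}). bad U))"
  proof
    fix R
    show "R \<in> ?good \<union> ({R. \<not> joined s {..<n} R} \<union> (\<Union>U\<in>(if 0 < b then K else {}). bad U))"
    proof (rule ccontr)
      assume nR: "\<not> ?thesis"
      then have J: "joined s {..<n} R" by auto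
      have "\<exists>f. cycle_copy n (G \<union> R) l f \<and> f ` {..<l} \<inter> (U \<union> H) = {}"
        if "0 < b" "U \<subseteq> {..<n}" "card U = l * b" for U
      proof -
        have "U \<in> K" using that by (simp add: K_def)
        then have "R \<notin> bad U" using nR that(1) by auto
        then show ?thesis using J unfolding bad_def by blast
      qed
      then have "has_disjoint_cycles n (G \<union> R) l m"
        using H unfolding b_def
        by (intro disjoint_cycles_with_hubs[OF l m G(1) J s(1,2) Hn]) (auto simp: H0_def)
      then show False using nR by auto
    qed
  qed
  then have "measure_pmf.prob ?M UNIV \<le> measure_pmf.prob ?M
      (?good \<union> ({R. \<not> joined s {..<n} R} \<union> (\<Union>U\<in>(if 0 < b then K else {}). bad U)))"
    by (intro measure_pmf.finite_measure_mono) auto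
  also have "\<dots> \<le> measure_pmf.prob ?M ?good + measure_pmf.prob ?M
      ({R. \<not> joined s {..<n} R} \<union> (\<Union>U\<in>(if 0 < b then K else {}). bad U))"
    by (rule measure_Un_le) auto
  also have "measure_pmf.prob ?M ({R. \<not> joined s {..<n} R} \<union> (\<Union>U\<in>(if 0 < b then K else {}). bad U))
      \<le> measure_pmf.prob ?M {R. \<not> joined s {..<n} R} +
        measure_pmf.prob ?M (\<Union>U\<in>(if 0 < b then K else {}). bad U)"
    by (rule measure_Un_le) auto
  finally show ?thesis using not_joined bad_prob by (simp add: measure_pmf_UNIV)
qed

theorem theorem1p6:
  fixes l :: nat
  assumes "l \<ge> 3"
  shows "\<exists>C::real. C > 0 \<and>
    (\<forall>(m :: nat \<Rightarrow> nat) (G :: nat \<Rightarrow> nat set set) (p :: nat \<Rightarrow> real).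
      (\<forall>\<^sub>F n in sequentially.
          1 \<le> m n \<and> real (m n) \<le> real n / (64 * real l ^ 2) \<and>
          is_graph n (G n) \<and> min_degree_ge n (G n) (m n) \<and>
          C * ln (real n) / real n \<le> p n \<and> p n \<le> 1)
      \<longrightarrow> ((\<lambda>n. measure_pmf.prob (gnp n (p n))
                 {H. has_disjoint_cycles n (G n \<union> H) l (m n)}) \<longlongrightarrow> 1) sequentially)"
\<comment> \<open>Here \<open>5120 = 10 * 256 * 2\<close>: 10 from the \<open>n / (10 * l)\<close>
  paths, 256 from the degree-level bound, 2 to beat the choices of \<open>U\<close>. One factor
  \<open>l\<close> stems from the number of paths, the other from the \<open>l * b\<close> vertices
  of \<open>U\<close>.\<close>
proof (intro exI[of _ "5120 * real l ^ 2"] conjI allI impI)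
  show "0 < 5120 * real l ^ 2" using assms by simp
next
  fix m :: "nat \<Rightarrow> nat" and G :: "nat \<Rightarrow> nat set set" and p :: "nat \<Rightarrow> real"
  assume hyp: "\<forall>\<^sub>F n in sequentially.
      1 \<le> m n \<and> real (m n) \<le> real n / (64 * real l ^ 2) \<and>
      is_graph n (G n) \<and> min_degree_ge n (G n) (m n) \<and>
      5120 * real l ^ 2 * ln (real n) / real n \<le> p n \<and> p n \<le> 1"
  let ?pr = "\<lambda>n. measure_pmf.prob (gnp n (p n)) {H. has_disjoint_cycles n (G n \<union> H) l (m n)}"
  have lower: "\<forall>\<^sub>F n in sequentially. 1 - 2 / real n \<le> ?pr n"
    using hyp eventually_ge_at_top[of "192 * l^2"] eventually_gt_at_top[of 0]
  proof eventually_elim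
    case (elim n)
    have "real (64 * l^2 * m n) \<le> real n"
      using elim assms by (simp add: field_simps)
    then have "64 * l^2 * m n \<le> n" by (simp only: of_nat_le_iff)
    moreover have "5120 * real l ^ 2 * ln (real n) \<le> p n * real n"
      using elim by (simp add: field_simps)
    ultimately show ?case using elim assms by (intro prob_disjoint_cycles) auto
  qed
  have "(\<lambda>n. 1 - 2 / real n) \<longlonglongrightarrow> 1 - 0"
    by (intro tendsto_diff tendsto_const lim_const_over_n)
  then show "?pr \<longlonglongrightarrow> 1"
    by (intro tendsto_sandwich[OF lower _ _ tendsto_const[of 1]]) simp_all
qed

end
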